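(* Let $N\in\mathbb{R}^{n\times m}$ with $n\le m$, let $r\in\{1,\dots,n\}$, and let $g:\mathbb{R}^{n\times m}\to\mathbb{R}\cup\{\infty\}$ be a closed proper convex function such that $g(M)<\infty$ for some $M$ with $\mathrm{rank}(M)\le r$. Let $D^\star$ be a minimizer of $$D\mapsto g^\ast(-D)+\tfrac12\|N+D\|_r^2-\tfrac12\|N\|_F^2\quad\text{over }D\in\mathbb{R}^{n\times m},$$ and let $M^\star$ be a minimizer of $$M\mapsto\tfrac12\|M\|_{r\ast}^2-\langle N,M\rangle+\tfrac12\|N\|_F^2+g(M)\quad\text{over }M\in\mathbb{R}^{n\times m}.$$ Suppose that an SVD of $N+D^\star$ is given by $N+D^\star=\sum_{i=1}^n\sigma_iu_iv_i^{\mathsf T}$ with $\sigma_r=\dots=\sigma_{r+s}\ne\sigma_{r+s+1}$, where $s=n-r$ if $\sigma_n=\sigma_r$. Then $$M^\star\in\mathrm{conv}(\mathrm{svd}_r(N+D^\star)).$$ In particular, $\mathrm{rank}(M^\star)\le r+s$. Moreover, if $\sigma_r\ne\sigma_{r+1}$ or $\sigma_r=0$, then $M^\star=\mathrm{svd}_r(N+D^\star)$.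
   Context: Matrices are real, $n\times m$ with $n\le m$; $\sigma_1(X)\ge\dots\ge\sigma_n(X)\ge 0$ are the singular values of $X$ counted with multiplicity (and singular values in an SVD are listed in non-increasing order); for $r=n$, in the condition $\sigma_r\neq\sigma_{r+1}$ use the convention $\sigma_{n+1}=0$. $\langle X,Y\rangle=\mathrm{trace}(X^{\mathsf T}Y)$ and $\|\cdot\|_F$ is the Frobenius norm. For $r\in\{1,\dots,n\}$, $\|M\|_r:=\sqrt{\sum_{i=1}^r\sigma_i^2(M)}$, and $\|M\|_{r\ast}:=\max_{\|X\|_r\le1}\langle M,X\rangle$ is its dual norm. A function is closed, proper, convex if its epigraph is closed, non-empty, convex respectively. The conjugate is $g^\ast(D):=\sup_M[\langle D,M\rangle-g(M)]$. $\mathrm{conv}$ denotes the convex hull, and $$\mathrm{svd}_r(X):=\left\{\sum_{i=1}^r\sigma_i(X)u_iv_i^{\mathsf T}: X=\sum_{i=1}^n\sigma_i(X)u_iv_i^{\mathsf T}\text{ is an SVD of }X\right\}.$$ When $\sigma_r(X)\ne\sigma_{r+1}(X)$ or $\sigma_r(X)=0$ this set is a singleton and $\mathrm{svd}_r(X)$ also denotes its unique element. *)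

theory Defs
  imports "HOL-Analysis.Analysis"
begin

text \<open>
  A real matrix with n rows and m columns has type \<open>real^'m^'n\<close>, with n = \<open>CARD('n)\<close> and
  m = \<open>CARD('m)\<close>. On this type the library norm is the Frobenius norm, and the library inner
  product is the trace inner product:
\<close>

lemma inner_matrix_eq_trace:
  fixes X Y :: "real^'m^'n"
  shows "X \<bullet> Y = trace (transpose X ** Y)"
proof -
  have "X \<bullet> Y = (\<Sum>i\<in>UNIV. \<Sum>j\<in>UNIV. X $ i $ j * Y $ i $ j)"
    by (simp add: inner_vec_def)
  also have "\<dots> = (\<Sum>j\<in>UNIV. \<Sum>i\<in>UNIV. X $ i $ j * Y $ i $ j)"
    by (rule sum.swap)
  also have "\<dots> = trace (transpose X ** Y)"
    by (simp add: trace_def transpose_def matrix_matrix_mult_def)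
  finally show ?thesis .
qed

definition outer_prod :: "real^'n \<Rightarrow> real^'m \<Rightarrow> real^'m^'n" where
  "outer_prod u v = (\<chi> i j. u $ i * v $ j)"

definition orthonormal_upto :: "nat \<Rightarrow> (nat \<Rightarrow> 'a::real_inner) \<Rightarrow> bool" where
  "orthonormal_upto k w \<longleftrightarrow>
     (\<forall>i\<in>{1..k}. \<forall>j\<in>{1..k}. w i \<bullet> w j = (if i = j then 1 else 0))"

text \<open>
  Intended for \<open>CARD('n) \<le> CARD('m)\<close>. Indices start at 1 (the values at 0 are irrelevant), and
  \<open>\<sigma>\<close> vanishes beyond n, which is the convention that the (n+1)-st singular value is 0.
\<close>

definition is_svd :: "real^'m^'n \<Rightarrow> (nat \<Rightarrow> real) \<Rightarrow> (nat \<Rightarrow> real^'n) \<Rightarrow> (nat \<Rightarrow> real^'m) \<Rightarrow> bool" where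
  "is_svd X \<sigma> u v \<longleftrightarrow>
     orthonormal_upto CARD('n) u \<and> orthonormal_upto CARD('n) v \<and>
     (\<forall>i j. 1 \<le> i \<longrightarrow> i \<le> j \<longrightarrow> \<sigma> j \<le> \<sigma> i) \<and>
     (\<forall>i\<ge>1. 0 \<le> \<sigma> i) \<and> (\<forall>i>CARD('n). \<sigma> i = 0) \<and>
     X = (\<Sum>i=1..CARD('n). \<sigma> i *\<^sub>R outer_prod (u i) (v i))"

text \<open>
  For \<open>CARD('n) \<le> CARD('m)\<close> every matrix has an SVD, and all its SVDs agree in \<open>\<sigma> i\<close> for every
  \<open>i \<ge> 1\<close>, so the description below is proper for such \<open>i\<close>.
\<close>

definition sing_val :: "real^'m^'n \<Rightarrow> nat \<Rightarrow> real" where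
  "sing_val X i = (THE t. \<exists>\<sigma> u v. is_svd X \<sigma> u v \<and> t = \<sigma> i)"

definition r_norm :: "nat \<Rightarrow> real^'m^'n \<Rightarrow> real" where
  "r_norm r M = sqrt (\<Sum>i=1..r. (sing_val M i)\<^sup>2)"

text \<open>The supremum is a maximum, since the unit ball of the r-norm is compact.\<close>

definition r_dual_norm :: "nat \<Rightarrow> real^'m^'n \<Rightarrow> real" where
  "r_dual_norm r M = (SUP X\<in>{X. r_norm r X \<le> 1}. M \<bullet> X)"

text \<open>\<open>is_svd\<close> ignores the value at index 0, so using \<open>sing_val X\<close> as its argument is harmless.\<close>

definition svd_trunc :: "nat \<Rightarrow> real^'m^'n \<Rightarrow> (real^'m^'n) set" where
  "svd_trunc r X =
     {(\<Sum>i=1..r. sing_val X i *\<^sub>R outer_prod (u i) (v i)) | u v. is_svd X (sing_val X) u v}"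

definition ereal_epigraph :: "('a \<Rightarrow> ereal) \<Rightarrow> ('a \<times> real) set" where
  "ereal_epigraph f = {(x, t). f x \<le> ereal t}"

definition closed_proper_convex :: "('a::real_normed_vector \<Rightarrow> ereal) \<Rightarrow> bool" where
  "closed_proper_convex f \<longleftrightarrow>
     closed (ereal_epigraph f) \<and> ereal_epigraph f \<noteq> {} \<and> convex (ereal_epigraph f)"

definition fenchel_conjugate :: "('a::real_inner \<Rightarrow> ereal) \<Rightarrow> 'a \<Rightarrow> ereal" where
  "fenchel_conjugate g D = (SUP M. ereal (D \<bullet> M) - g M)"

end

theory Submission
  imports Defs
begin

text \<open>
  Put \<open>Y = N + Dstar\<close> and let f be half the squared r-norm. Half the squared dual norm is, up to the
  linear term in \<open>N\<close> and a constant, the finite summand of the primal problem, and it is conjugate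
  to f. The proof shows that \<open>Mstar\<close> is a subgradient of f at \<open>Y\<close>, and that all subgradients of f at
  \<open>Y\<close> lie in the convex hull of the truncated singular value decompositions of \<open>Y\<close>.

  The first half is Fenchel duality, started at the primal minimiser. A hyperplane that separates the
  epigraph of \<open>g\<close> from the hypograph given by the finite summand (\<open>separating_subgradient\<close>) produces a
  dual point that closes the duality gap. Consequently \<open>Dstar\<close> closes it too, and the Fenchel-Young
  inequality for f is an equality at \<open>Mstar\<close> and \<open>Y\<close> (\<open>optimal_pair_fenchel_equality\<close>).

  The second half rests on the fact that f is a maximum of affine functions: f at \<open>X\<close> is the maximum
  of \<open>P \<bullet> X - 1/2 * (norm P)\<^sup>2\<close> over the matrices \<open>P\<close> of rank at most r, and truncations of \<open>X\<close> are
  maximisers. The upper bound is a trace inequality (\<open>inner_rank_r_le\<close>), a consequence of Ky Fan's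
  maximum principle (\<open>ky_fan_sum_squares\<close>), which also shows that singular values are unique. As the
  graph of the truncation map is compact (\<open>compact_svd_trunc_graph\<close>), Danskin's argument bounds the
  directional derivatives of f at \<open>Y\<close> by pairings with truncations of \<open>Y\<close>, and a separating hyperplane
  puts every subgradient into their hull (\<open>fenchel_equality_imp_svd_trunc_hull\<close>).

  The rank bound and the uniqueness statement compare two decompositions of \<open>Y\<close>: left singular vectors
  for different singular values are orthogonal, so every truncation has its column space inside the
  span of the first \<open>r + s\<close> left singular vectors of the given decomposition
  (\<open>rank_svd_trunc_hull_le\<close>), and a gap after index r determines the truncation
  (\<open>svd_trunc_unique\<close>).
\<close>

section \<open>Orthonormal families\<close>

lemma orthonormal_uptoD:
  assumes "orthonormal_upto k w" "i \<in> {1..k}" "j \<in> {1..k}"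
  shows "w i \<bullet> w j = (if i = j then 1 else 0)"
  using assms by (auto simp: orthonormal_upto_def)

lemma orthonormal_upto_norm:
  assumes "orthonormal_upto k w" "i \<in> {1..k}"
  shows "norm (w i) = 1"
  using orthonormal_uptoD[OF assms assms(2)] by (simp add: norm_eq_1)

lemma orthonormal_upto_mono:
  "orthonormal_upto k w \<Longrightarrow> l \<le> k \<Longrightarrow> orthonormal_upto l w"
  by (auto simp: orthonormal_upto_def)

lemma inner_sum_orthonormal:
  assumes "orthonormal_upto k w" "j \<in> {1..k}"
  shows "(\<Sum>i=1..k. c i *\<^sub>R w i) \<bullet> w j = c j"
proof -
  have "(\<Sum>i=1..k. c i *\<^sub>R w i) \<bullet> w j = (\<Sum>i=1..k. c i * (w i \<bullet> w j))"
    by (simp add: inner_sum_left)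
  also have "\<dots> = (\<Sum>i=1..k. if i = j then c j else 0)"
    by (rule sum.cong) (auto simp: orthonormal_uptoD[OF assms(1) _ assms(2)])
  finally show ?thesis
    using assms(2) by simp
qed

lemma norm_sum_orthonormal:
  assumes "orthonormal_upto k w"
  shows "(norm (\<Sum>i=1..k. c i *\<^sub>R w i))\<^sup>2 = (\<Sum>i=1..k. (c i)\<^sup>2)"
proof -
  let ?x = "\<Sum>i=1..k. c i *\<^sub>R w i"
  have "(norm ?x)\<^sup>2 = (\<Sum>j=1..k. c j * (?x \<bullet> w j))"
    by (simp only: power2_norm_eq_inner inner_sum_right inner_scaleR_right)
  also have "\<dots> = (\<Sum>j=1..k. (c j)\<^sup>2)"
    by (rule sum.cong) (simp_all only: inner_sum_orthonormal[OF assms] power2_eq_square)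
  finally show ?thesis .
qed

lemma bessel_inequality:
  assumes "orthonormal_upto k w"
  shows "(\<Sum>i=1..k. (w i \<bullet> x)\<^sup>2) \<le> (norm x)\<^sup>2"
proof -
  let ?p = "\<Sum>i=1..k. (w i \<bullet> x) *\<^sub>R w i"
  have 1: "(norm ?p)\<^sup>2 = (\<Sum>i=1..k. (w i \<bullet> x)\<^sup>2)"
    by (rule norm_sum_orthonormal[OF assms])
  have "?p \<bullet> x = (\<Sum>i=1..k. (w i \<bullet> x)\<^sup>2)"
    by (simp add: inner_sum_left power2_eq_square)
  moreover have "(norm (x - ?p))\<^sup>2 = (norm x)\<^sup>2 - 2 * (?p \<bullet> x) + (norm ?p)\<^sup>2"
    by (simp add: power2_norm_eq_inner inner_diff_left inner_diff_right inner_commute)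
  ultimately show ?thesis
    using 1 zero_le_power2[of "norm (x - ?p)"] by linarith
qed

lemma orthonormal_upto_independent:
  assumes "orthonormal_upto k w"
  shows "inj_on w {1..k}" "independent (w ` {1..k})"
proof -
  show "inj_on w {1..k}"
    by (rule inj_onI)
      (metis orthonormal_uptoD[OF assms] zero_neq_one)
  show "independent (w ` {1..k})"
  proof (rule pairwise_orthogonal_independent)
    show "pairwise orthogonal (w ` {1..k})"
      by (auto simp: pairwise_def orthogonal_def orthonormal_uptoD[OF assms])
    show "0 \<notin> w ` {1..k}"
      using orthonormal_upto_norm[OF assms] by fastforce
  qed
qed

lemma orthonormal_basis_expansion:
  fixes u :: "nat \<Rightarrow> real^'n"
  assumes "orthonormal_upto CARD('n) u"
  shows "(\<Sum>i=1..CARD('n). (x \<bullet> u i) *\<^sub>R u i) = x"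
proof -
  let ?B = "u ` {1..CARD('n)}"
  note I = orthonormal_upto_independent[OF assms]
  have "card ?B = DIM(real^'n)"
    using I(1) by (simp add: card_image)
  then have "x \<in> span ?B"
    using I(2) card_eq_dim[of ?B UNIV] by (auto simp: dim_UNIV)
  moreover have "pairwise orthogonal ?B"
    by (auto simp: pairwise_def orthogonal_def orthonormal_uptoD[OF assms])
  ultimately have "(\<Sum>b\<in>?B. (x \<bullet> b) *\<^sub>R b) = x"
    by (intro orthonormal_basis_expand)
      (auto simp: orthonormal_upto_norm[OF assms])
  then show ?thesis
    by (simp only: sum.reindex[OF I(1)] comp_def)
qed

lemma orthonormal_basis_eqI:
  fixes u :: "nat \<Rightarrow> real^'n"
  assumes "orthonormal_upto CARD('n) u"
    and "\<And>j. j \<in> {1..CARD('n)} \<Longrightarrow> x \<bullet> u j = y \<bullet> u j"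
  shows "x = y"
proof -
  have "x = (\<Sum>i=1..CARD('n). (x \<bullet> u i) *\<^sub>R u i)"
    by (simp only: orthonormal_basis_expansion[OF assms(1)])
  also have "\<dots> = (\<Sum>i=1..CARD('n). (y \<bullet> u i) *\<^sub>R u i)"
    by (rule sum.cong) (simp_all only: assms(2))
  finally show ?thesis
    by (simp only: orthonormal_basis_expansion[OF assms(1)])
qed

section \<open>Singular value decompositions\<close>

lemma outer_prod_inner:
  "outer_prod a b \<bullet> Y = a \<bullet> (Y *v b)"
  by (simp add: outer_prod_def inner_vec_def matrix_vector_mult_def sum_distrib_left
      mult_ac sum_distrib_right)

lemma outer_prod_mult_vec: "outer_prod a b *v x = (b \<bullet> x) *\<^sub>R a"
  by (simp add: vec_eq_iff outer_prod_def inner_vec_def matrix_vector_mult_def sum_distrib_left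
      mult_ac sum_distrib_right)

lemma outer_prod_inner_outer_prod:
  "outer_prod a b \<bullet> outer_prod c d = (a \<bullet> c) * (b \<bullet> d)"
  by (simp add: outer_prod_inner outer_prod_mult_vec inner_commute)

lemma orthonormal_outer_prod:
  assumes "orthonormal_upto k a" "orthonormal_upto k b"
  shows "orthonormal_upto k (\<lambda>i. outer_prod (a i) (b i))"
  using assms by (simp add: orthonormal_upto_def outer_prod_inner_outer_prod)

lemma outer_sum_inner:
  "(\<Sum>i\<in>I. c i *\<^sub>R outer_prod (a i) (b i)) \<bullet> Y = (\<Sum>i\<in>I. c i * (a i \<bullet> (Y *v b i)))"
  by (simp add: inner_sum_left outer_prod_inner)

lemma bilinear_outer_sum:
  "x \<bullet> ((\<Sum>i\<in>I. c i *\<^sub>R outer_prod (a i) (b i)) *v y)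
    = (\<Sum>i\<in>I. c i * (x \<bullet> a i) * (y \<bullet> b i))"
proof -
  have "x \<bullet> ((\<Sum>i\<in>I. c i *\<^sub>R outer_prod (a i) (b i)) *v y)
      = outer_prod x y \<bullet> (\<Sum>i\<in>I. c i *\<^sub>R outer_prod (a i) (b i))"
    by (simp only: outer_prod_inner)
  also have "\<dots> = (\<Sum>i\<in>I. c i * (x \<bullet> a i) * (y \<bullet> b i))"
    by (simp add: inner_sum_right outer_prod_inner_outer_prod mult.assoc)
  finally show ?thesis .
qed

lemma outer_sum_vec_mult:
  "x v* (\<Sum>i\<in>I. c i *\<^sub>R outer_prod (a i) (b i)) = (\<Sum>i\<in>I. (c i * (x \<bullet> a i)) *\<^sub>R b i)"
proof -
  let ?S = "\<Sum>i\<in>I. c i *\<^sub>R outer_prod (a i) (b i)"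
  have "(x v* ?S) \<bullet> y = (\<Sum>i\<in>I. (c i * (x \<bullet> a i)) *\<^sub>R b i) \<bullet> y" for y
  proof -
    have "(x v* ?S) \<bullet> y = y \<bullet> (\<Sum>i\<in>I. (c i * (x \<bullet> a i)) *\<^sub>R b i)"
      unfolding dot_lmul_matrix bilinear_outer_sum by (simp add: inner_sum_right)
    also have "\<dots> = (\<Sum>i\<in>I. (c i * (x \<bullet> a i)) *\<^sub>R b i) \<bullet> y"
      by (rule inner_commute)
    finally show ?thesis .
  qed
  then show ?thesis
    by (rule vector_eq_rdot[THEN iffD1, OF allI])
qed

lemma is_svdD:
  fixes X :: "real^'m^'n"
  assumes "is_svd X \<sigma> u v"
  shows "orthonormal_upto CARD('n) u" "orthonormal_upto CARD('n) v"
    and "\<And>i j. 1 \<le> i \<Longrightarrow> i \<le> j \<Longrightarrow> \<sigma> j \<le> \<sigma> i"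
    and "\<And>i. 1 \<le> i \<Longrightarrow> 0 \<le> \<sigma> i" "\<And>i. CARD('n) < i \<Longrightarrow> \<sigma> i = 0"
    and "X = (\<Sum>i=1..CARD('n). \<sigma> i *\<^sub>R outer_prod (u i) (v i))"
  using assms by (auto simp: is_svd_def)

text \<open>
  The value at index 0, and the vectors outside \<open>{1..n}\<close>, are free; changing them is used to replace the
  singular values by the canonical function \<open>sing_val\<close> and to place all entries in a compact set.
\<close>

lemma is_svd_cong:
  fixes X :: "real^'m^'n"
  assumes "is_svd X \<sigma> u v"
    and "\<And>i. 1 \<le> i \<Longrightarrow> \<sigma>' i = \<sigma> i"
    and "\<And>i. i \<in> {1..CARD('n)} \<Longrightarrow> u' i = u i \<and> v' i = v i"
  shows "is_svd X \<sigma>' u' v'"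
proof -
  have "(\<Sum>i=1..CARD('n). \<sigma>' i *\<^sub>R outer_prod (u' i) (v' i))
      = (\<Sum>i=1..CARD('n). \<sigma> i *\<^sub>R outer_prod (u i) (v i))"
    by (rule sum.cong) (simp_all add: assms(2,3))
  moreover have "orthonormal_upto CARD('n) u'" "orthonormal_upto CARD('n) v'"
    using is_svdD(1,2)[OF assms(1)] assms(3) by (simp_all add: orthonormal_upto_def)
  ultimately show ?thesis
    unfolding is_svd_def using is_svdD(3-6)[OF assms(1)] assms(2) by simp
qed

lemma svd_left_mult:
  fixes Y :: "real^'m^'n"
  assumes "is_svd Y \<sigma> u v"
  shows "x v* Y = (\<Sum>j=1..CARD('n). (\<sigma> j * (x \<bullet> u j)) *\<^sub>R v j)"
  by (subst is_svdD(6)[OF assms]) (rule outer_sum_vec_mult)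

lemma svd_left_mult_singular_vector:
  fixes Y :: "real^'m^'n"
  assumes "is_svd Y \<sigma> u v" "i \<in> {1..CARD('n)}"
  shows "u i v* Y = \<sigma> i *\<^sub>R v i"
proof -
  have "u i v* Y = (\<Sum>j=1..CARD('n). if j = i then \<sigma> i *\<^sub>R v i else 0)"
    unfolding svd_left_mult[OF assms(1)]
    by (rule sum.cong) (auto simp: orthonormal_uptoD[OF is_svdD(1)[OF assms(1)] assms(2)])
  then show ?thesis
    using assms(2) by simp
qed

lemma svd_norm:
  fixes Y :: "real^'m^'n"
  assumes "is_svd Y \<sigma> u v"
  shows "(norm Y)\<^sup>2 = (\<Sum>i=1..CARD('n). (\<sigma> i)\<^sup>2)"
  by (subst is_svdD(6)[OF assms])
    (rule norm_sum_orthonormal[OF orthonormal_outer_prod[OF is_svdD(1,2)[OF assms]]])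

lemma svd_scale:
  fixes Y :: "real^'m^'n"
  assumes "is_svd Y \<sigma> u v" "0 \<le> c"
  shows "is_svd (c *\<^sub>R Y) (\<lambda>i. c * \<sigma> i) u v"
  unfolding is_svd_def using is_svdD[OF assms(1)] assms(2)
  by (auto simp: scaleR_sum_right mult_left_mono)

section \<open>The trace inequality and uniqueness of singular values\<close>

text \<open>
  Moving the weights, of total at most k, to the k largest entries can only increase the sum: an index up to k
  has entry at least \<open>c k\<close> and loses weight relative to the indicator of \<open>{1..k}\<close>, an index beyond k
  has entry at most \<open>c k\<close> and gains it.
\<close>

lemma weighted_sum_decreasing_le:
  fixes c w :: "nat \<Rightarrow> real"
  assumes "1 \<le> k" "k \<le> n"
    and dec: "\<And>i j. 1 \<le> i \<Longrightarrow> i \<le> j \<Longrightarrow> c j \<le> c i" and "0 \<le> c k"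
    and w: "\<And>j. j \<in> {1..n} \<Longrightarrow> 0 \<le> w j \<and> w j \<le> 1" and "(\<Sum>j=1..n. w j) \<le> real k"
  shows "(\<Sum>j=1..n. c j * w j) \<le> (\<Sum>j=1..k. c j)"
proof -
  define e :: "nat \<Rightarrow> real" where "e j = (if j \<le> k then 1 else 0)" for j
  have S: "(\<Sum>j=1..n. f j * e j) = (\<Sum>j=1..k. f j)" for f :: "nat \<Rightarrow> real"
  proof -
    have "(\<Sum>j=1..n. f j * e j) = (\<Sum>j\<in>{1..k}. f j * e j)"
      using assms(2) by (intro sum.mono_neutral_right) (auto simp: e_def)
    then show ?thesis
      by (simp add: e_def)
  qed
  have "(\<Sum>j=1..n. c j * w j) - (\<Sum>j=1..n. c j * e j) = (\<Sum>j=1..n. c j * (w j - e j))"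
    by (simp add: sum_subtractf right_diff_distrib)
  also have "\<dots> \<le> (\<Sum>j=1..n. c k * (w j - e j))"
  proof (rule sum_mono)
    fix j assume j: "j \<in> {1..n}"
    show "c j * (w j - e j) \<le> c k * (w j - e j)"
    proof (cases "j \<le> k")
      case True
      then show ?thesis
        using dec[of j k] j w[OF j] by (intro mult_right_mono_neg) (auto simp: e_def)
    next
      case False
      then show ?thesis
        using dec[of k j] assms(1) w[OF j] by (intro mult_right_mono) (auto simp: e_def)
    qed
  qed
  also have "\<dots> = c k * ((\<Sum>j=1..n. w j) - real k)"
    using S[of "\<lambda>_. 1"] by (simp add: sum_distrib_left[symmetric] sum_subtractf)
  also have "\<dots> \<le> 0"
    using assms(4,6) by (simp add: mult_nonneg_nonpos)
  finally show ?thesis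
    by (simp only: S diff_le_0_iff_le)
qed

text \<open>
  Ky Fan's maximum principle. In the singular basis the left-hand side is the sum of the squared
  singular values with weights \<open>w j\<close>, the squared length of the projection of \<open>u j\<close> onto the span of
  the \<open>a i\<close>. Bessel's inequality, used once for each family, bounds every weight by 1 and their sum
  by k.
\<close>

lemma ky_fan_sum_squares:
  fixes Y :: "real^'m^'n"
  assumes svd: "is_svd Y \<sigma> u v" and a: "orthonormal_upto k a" and "k \<le> CARD('n)"
  shows "(\<Sum>i=1..k. (norm (a i v* Y))\<^sup>2) \<le> (\<Sum>i=1..k. (\<sigma> i)\<^sup>2)"
proof (cases "k = 0")
  case False
  note D = is_svdD[OF svd]
  define w where "w j = (\<Sum>i=1..k. (a i \<bullet> u j)\<^sup>2)" for j
  have "(\<Sum>i=1..k. (norm (a i v* Y))\<^sup>2) = (\<Sum>i=1..k. \<Sum>j=1..CARD('n). (\<sigma> j * (a i \<bullet> u j))\<^sup>2)"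
    by (simp only: svd_left_mult[OF svd] norm_sum_orthonormal[OF D(2)])
  also have "\<dots> = (\<Sum>j=1..CARD('n). (\<sigma> j)\<^sup>2 * w j)"
    unfolding w_def sum_distrib_left power_mult_distrib by (rule sum.swap)
  also have "\<dots> \<le> (\<Sum>j=1..k. (\<sigma> j)\<^sup>2)"
  proof (rule weighted_sum_decreasing_le)
    show "1 \<le> k" "k \<le> CARD('n)"
      using False assms(3) by auto
    show "(\<sigma> j)\<^sup>2 \<le> (\<sigma> i)\<^sup>2" if "1 \<le> i" "i \<le> j" for i j
      using D(3)[of i j] D(4)[of j] that by (intro power_mono) auto
    show "0 \<le> w j \<and> w j \<le> 1" if j: "j \<in> {1..CARD('n)}" for j
      using bessel_inequality[OF a, of "u j"] orthonormal_upto_norm[OF D(1) j]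
      unfolding w_def by (simp add: sum_nonneg)
    have "(\<Sum>j=1..CARD('n). w j) = (\<Sum>i=1..k. \<Sum>j=1..CARD('n). (u j \<bullet> a i)\<^sup>2)"
      unfolding w_def by (subst sum.swap) (simp only: inner_commute[of "a _"])
    also have "\<dots> \<le> (\<Sum>i=1..k. 1)"
      proof (rule sum_mono)
      fix i assume "i \<in> {1..k}"
      then have "norm (a i) = 1"
        by (rule orthonormal_upto_norm[OF a])
      then show "(\<Sum>j=1..CARD('n). (u j \<bullet> a i)\<^sup>2) \<le> 1"
        using bessel_inequality[OF D(1), of "a i"] by simp
    qed
    finally show "(\<Sum>j=1..CARD('n). w j) \<le> real k"
      by simp
  qed simp
  finally show ?thesis .
qed simp

text \<open>
  The left singular vectors of one decomposition compete in the maximum principle for the other.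
  By symmetry all partial sums of squares agree, and so do the singular values.
\<close>

lemma svd_sum_squares_le:
  fixes Y :: "real^'m^'n"
  assumes "is_svd Y \<sigma> u v" "is_svd Y \<sigma>' u' v'" "k \<le> CARD('n)"
  shows "(\<Sum>i=1..k. (\<sigma>' i)\<^sup>2) \<le> (\<Sum>i=1..k. (\<sigma> i)\<^sup>2)"
proof -
  note D = is_svdD[OF assms(2)]
  have "(\<Sum>i=1..k. (\<sigma>' i)\<^sup>2) = (\<Sum>i=1..k. (norm (u' i v* Y))\<^sup>2)"
  proof (rule sum.cong)
    fix i assume "i \<in> {1..k}"
    then have i: "i \<in> {1..CARD('n)}"
      using assms(3) by auto
    show "(\<sigma>' i)\<^sup>2 = (norm (u' i v* Y))\<^sup>2"
      by (simp add: svd_left_mult_singular_vector[OF assms(2) i] orthonormal_upto_norm[OF D(2) i])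
  qed simp
  also have "\<dots> \<le> (\<Sum>i=1..k. (\<sigma> i)\<^sup>2)"
    using ky_fan_sum_squares[OF assms(1) orthonormal_upto_mono[OF D(1) assms(3)] assms(3)] .
  finally show ?thesis .
qed

lemma singular_values_unique:
  fixes Y :: "real^'m^'n"
  assumes "is_svd Y \<sigma> u v" "is_svd Y \<sigma>' u' v'" "1 \<le> i"
  shows "\<sigma> i = \<sigma>' i"
proof (cases "i \<le> CARD('n)")
  case True
  have S: "(\<Sum>i=1..k. (\<sigma>' i)\<^sup>2) = (\<Sum>i=1..k. (\<sigma> i)\<^sup>2)" if "k \<le> CARD('n)" for k
    using svd_sum_squares_le[OF assms(1,2) that] svd_sum_squares_le[OF assms(2,1) that]
    by linarith
  obtain k where k: "i = Suc k"
    using assms(3) by (cases i) auto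
  have "(\<sigma>' i)\<^sup>2 = (\<sigma> i)\<^sup>2"
    using S[of k] S[of i] True by (simp add: k)
  then show ?thesis
    using is_svdD(4)[OF assms(1,3)] is_svdD(4)[OF assms(2,3)] by (simp add: power2_eq_iff_nonneg)
next
  case False
  then show ?thesis
    using is_svdD(5)[OF assms(1)] is_svdD(5)[OF assms(2)] by simp
qed

lemma sing_val_eq:
  fixes X :: "real^'m^'n"
  assumes "is_svd X \<sigma> u v" "1 \<le> i"
  shows "sing_val X i = \<sigma> i"
  unfolding sing_val_def
proof (rule the_equality)
  show "\<exists>\<sigma>' u v. is_svd X \<sigma>' u v \<and> \<sigma> i = \<sigma>' i"
    using assms(1) by blast
  show "t = \<sigma> i" if "\<exists>\<sigma>' u v. is_svd X \<sigma>' u v \<and> t = \<sigma>' i" for t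
    using that singular_values_unique[OF _ assms] by blast
qed

lemma is_svd_sing_val:
  "is_svd X \<sigma> u v \<Longrightarrow> is_svd X (sing_val X) u v"
  by (rule is_svd_cong) (auto simp: sing_val_eq)

lemma r_norm_svd:
  assumes "is_svd X \<sigma> u v"
  shows "(r_norm r X)\<^sup>2 = (\<Sum>i=1..r. (\<sigma> i)\<^sup>2)"
proof -
  have "(\<Sum>i=1..r. (sing_val X i)\<^sup>2) = (\<Sum>i=1..r. (\<sigma> i)\<^sup>2)"
    by (rule sum.cong) (simp_all add: sing_val_eq[OF assms])
  then show ?thesis
    by (simp add: r_norm_def sum_nonneg)
qed

lemma r_norm_nonneg: "0 \<le> r_norm r X"
  by (simp add: r_norm_def sum_nonneg)

text \<open>
  The rank-r form of von Neumann's trace inequality: pairing with a matrix of rank at most r sees only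
  the r largest singular values of \<open>Y\<close>.
\<close>

lemma inner_rank_r_le:
  fixes Y :: "real^'m^'n"
  assumes svd: "is_svd Y \<sigma> u v"
    and a: "orthonormal_upto r a" and b: "orthonormal_upto r b" and r: "r \<le> CARD('n)"
    and P: "P = (\<Sum>i=1..r. \<tau> i *\<^sub>R outer_prod (a i) (b i))"
  shows "P \<bullet> Y \<le> norm P * r_norm r Y"
proof (rule power2_le_imp_le)
  have "(P \<bullet> Y)\<^sup>2 = (\<Sum>i=1..r. \<tau> i * (a i \<bullet> (Y *v b i)))\<^sup>2"
    by (simp add: P outer_sum_inner)
  also have "\<dots> \<le> (\<Sum>i=1..r. (\<tau> i)\<^sup>2) * (\<Sum>i=1..r. (a i \<bullet> (Y *v b i))\<^sup>2)"
    by (rule Cauchy_Schwarz_ineq_sum)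
  also have "\<dots> \<le> (\<Sum>i=1..r. (\<tau> i)\<^sup>2) * (r_norm r Y)\<^sup>2"
  proof (rule mult_left_mono)
    have "(\<Sum>i=1..r. (a i \<bullet> (Y *v b i))\<^sup>2) \<le> (\<Sum>i=1..r. (norm (a i v* Y))\<^sup>2)"
    proof (rule sum_mono)
      fix i assume i: "i \<in> {1..r}"
      have "\<bar>a i \<bullet> (Y *v b i)\<bar> \<le> norm (a i v* Y) * norm (b i)"
        unfolding dot_lmul_matrix[symmetric] by (rule Cauchy_Schwarz_ineq2)
      then show "(a i \<bullet> (Y *v b i))\<^sup>2 \<le> (norm (a i v* Y))\<^sup>2"
        using orthonormal_upto_norm[OF b i] by (simp add: abs_le_square_iff[symmetric])
    qed
    also have "\<dots> \<le> (r_norm r Y)\<^sup>2"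
      unfolding r_norm_svd[OF svd] by (rule ky_fan_sum_squares[OF svd a r])
    finally show "(\<Sum>i=1..r. (a i \<bullet> (Y *v b i))\<^sup>2) \<le> (r_norm r Y)\<^sup>2" .
  qed (simp add: sum_nonneg)
  also have "\<dots> = (norm P * r_norm r Y)\<^sup>2"
    by (simp only: P norm_sum_orthonormal[OF orthonormal_outer_prod[OF a b]] power_mult_distrib)
  finally show "(P \<bullet> Y)\<^sup>2 \<le> (norm P * r_norm r Y)\<^sup>2" .
qed (simp add: r_norm_nonneg)

section \<open>Existence of singular value decompositions\<close>

lemma exists_unit_orthogonal:
  fixes w :: "nat \<Rightarrow> real^'k"
  assumes "k < CARD('k)"
  shows "\<exists>x. norm x = 1 \<and> (\<forall>i\<in>{1..k}. x \<bullet> w i = 0)"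
proof -
  have "dim (span (w ` {1..k})) < DIM(real^'k)"
  proof -
    have "dim (w ` {1..k}) \<le> card {1..k}"
      by (meson card_image_le dim_le_card' finite_atLeastAtMost finite_imageI order_trans)
    then show ?thesis
      using assms by simp
  qed
  then obtain y where y: "y \<noteq> 0" "\<And>z. z \<in> span (span (w ` {1..k})) \<Longrightarrow> orthogonal y z"
    using orthogonal_to_subspace_exists by metis
  have "y \<bullet> w i = 0" if "i \<in> {1..k}" for i
    using y(2)[of "w i"] that by (simp add: orthogonal_def span_base)
  then show ?thesis
    using y(1) by (intro exI[of _ "y /\<^sub>R norm y"]) auto
qed

lemma equality_in_cauchy_schwarz:
  fixes x z :: "'a::real_inner"
  assumes "norm x = 1" "z \<bullet> x = s" "norm z \<le> s"
  shows "z = s *\<^sub>R x"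
proof -
  have "(norm (z - s *\<^sub>R x))\<^sup>2 = (norm z)\<^sup>2 - s\<^sup>2"
    using assms(1,2) unfolding power2_norm_eq_inner norm_eq_1
    by (simp add: inner_diff_left inner_diff_right inner_commute power2_eq_square)
  also have "\<dots> \<le> 0"
    using power_mono[OF assms(3), of 2] by simp
  finally show ?thesis
    by simp
qed

text \<open>
  The supremum of \<open>z \<bullet> x\<close> over unit vectors orthogonal to the \<open>w i\<close> is the norm of \<open>z\<close> as soon
  as \<open>z\<close> itself is orthogonal to them: the normalisation of \<open>z\<close> is an admissible competitor.
\<close>

lemma norm_le_of_unit_bound:
  fixes z :: "'a::real_inner"
  assumes "\<And>x. norm x = 1 \<Longrightarrow> \<forall>i\<in>I. x \<bullet> w i = 0 \<Longrightarrow> z \<bullet> x \<le> s" "\<forall>i\<in>I. z \<bullet> w i = 0" "0 \<le> s"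
  shows "norm z \<le> s"
proof (cases "z = 0")
  case False
  then have "z \<bullet> (z /\<^sub>R norm z) \<le> s"
    using assms(2) by (intro assms(1)) auto
  then show ?thesis
    using False by (simp add: power2_norm_eq_inner[symmetric] power2_eq_square flip: mult.assoc)
qed (use assms in simp)

text \<open>
  The greedy construction stops after \<open>k\<close> singular triples. The last clause is what makes the
  next singular value fit below the previous ones: on the orthogonal complements of the vectors
  already found, the bilinear form of \<open>X\<close> is bounded by every singular value found so far.
\<close>

definition partial_svd ::
  "real^'m^'n \<Rightarrow> nat \<Rightarrow> (nat \<Rightarrow> real) \<Rightarrow> (nat \<Rightarrow> real^'n) \<Rightarrow> (nat \<Rightarrow> real^'m) \<Rightarrow> bool" where
  "partial_svd X k \<sigma> u v \<longleftrightarrow>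
     orthonormal_upto k u \<and> orthonormal_upto k v \<and>
     (\<forall>i\<in>{1..k}. 0 \<le> \<sigma> i \<and> X *v v i = \<sigma> i *\<^sub>R u i \<and> u i v* X = \<sigma> i *\<^sub>R v i) \<and>
     (\<forall>i\<in>{1..k}. \<forall>j\<in>{1..k}. i \<le> j \<longrightarrow> \<sigma> j \<le> \<sigma> i) \<and>
     (\<forall>l\<in>{1..k}. \<forall>x y. norm x = 1 \<and> norm y = 1 \<and> (\<forall>i\<in>{1..k}. x \<bullet> u i = 0 \<and> y \<bullet> v i = 0)
        \<longrightarrow> x \<bullet> (X *v y) \<le> \<sigma> l)"

lemma orthonormal_upto_extend:
  assumes "orthonormal_upto k w" "norm x = 1" "\<forall>i\<in>{1..k}. x \<bullet> w i = 0"
  shows "orthonormal_upto (Suc k) (w(Suc k := x))"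
  unfolding orthonormal_upto_def
proof (intro ballI)
  fix i j assume ij: "i \<in> {1..Suc k}" "j \<in> {1..Suc k}"
  have "i \<in> {1..k} \<or> i = Suc k" "j \<in> {1..k} \<or> j = Suc k"
    using ij by auto
  then show "(w(Suc k := x)) i \<bullet> (w(Suc k := x)) j = (if i = j then 1 else 0)"
    using assms(2,3) orthonormal_uptoD[OF assms(1)]
    by (auto simp: norm_eq_1 inner_commute)
qed

text \<open>
  Maximise \<open>x \<bullet> (X *v y)\<close> over unit vectors in the two orthogonal complements, which are nonzero
  because \<open>k\<close> is below both dimensions. Both complements are invariant: \<open>X *v y\<close> is again orthogonal
  to all \<open>u i\<close>, and \<open>x v* X\<close> to all \<open>v i\<close>. Hence maximality bounds the norms of these vectors by the
  maximum \<open>s\<close>, and equality in the Cauchy-Schwarz inequality turns them into \<open>s\<close> times \<open>x\<close> and \<open>y\<close>.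
\<close>

lemma partial_svd_step:
  fixes X :: "real^'m^'n"
  assumes P: "partial_svd X k \<sigma> u v" and k: "k < CARD('n)" "k < CARD('m)"
  shows "\<exists>\<sigma> u v. partial_svd X (Suc k) \<sigma> u v"
proof -
  define U where "U = {x. norm x = 1 \<and> (\<forall>i\<in>{1..k}. x \<bullet> u i = 0)}"
  define V where "V = {y. norm y = 1 \<and> (\<forall>i\<in>{1..k}. y \<bullet> v i = 0)}"
  have comp: "compact {x. norm x = 1 \<and> (\<forall>i\<in>{1..k}. x \<bullet> w i = 0)}" for w :: "nat \<Rightarrow> 'c::euclidean_space"
  proof -
    have "{x. norm x = 1 \<and> (\<forall>i\<in>{1..k}. x \<bullet> w i = 0)}
        = sphere 0 1 \<inter> (\<Inter>i\<in>{1..k}. {x. x \<bullet> w i = 0})"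
      by auto
    moreover have "closed (\<Inter>i\<in>{1..k}. {x. x \<bullet> w i = 0})"
      by (intro closed_INT ballI closed_Collect_eq continuous_intros)
    ultimately show ?thesis
      by (simp add: compact_Int_closed)
  qed
  have "compact (U \<times> V)" "U \<times> V \<noteq> {}"
    using comp[of u] comp[of v] exists_unit_orthogonal[OF k(1), of u] exists_unit_orthogonal[OF k(2), of v]
    by (auto simp: U_def V_def compact_Times)
  moreover have "continuous_on (U \<times> V) (\<lambda>p. fst p \<bullet> (X *v snd p))"
    by (intro continuous_intros continuous_on_compose2[OF matrix_vector_mult_linear_continuous_on[of UNIV X] continuous_on_snd]) auto
  ultimately obtain p where p: "p \<in> U \<times> V" "\<forall>q\<in>U \<times> V. fst q \<bullet> (X *v snd q) \<le> fst p \<bullet> (X *v snd p)"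
    using continuous_attains_sup by blast
  obtain x y where xy: "p = (x, y)"
    by (cases p)
  define s where "s = x \<bullet> (X *v y)"
  have x: "norm x = 1" "\<forall>i\<in>{1..k}. x \<bullet> u i = 0" and y: "norm y = 1" "\<forall>i\<in>{1..k}. y \<bullet> v i = 0"
    using p(1) by (auto simp: xy U_def V_def)
  have max: "x' \<bullet> (X *v y') \<le> s"
    if "norm x' = 1" "\<forall>i\<in>{1..k}. x' \<bullet> u i = 0" "norm y' = 1" "\<forall>i\<in>{1..k}. y' \<bullet> v i = 0" for x' y'
    using p(2) that by (force simp: xy U_def V_def s_def)
  have s0: "0 \<le> s"
    using max[of "- x" y] x y by (simp add: s_def)
  have PD: "\<And>i. i \<in> {1..k} \<Longrightarrow> 0 \<le> \<sigma> i \<and> X *v v i = \<sigma> i *\<^sub>R u i \<and> u i v* X = \<sigma> i *\<^sub>R v i"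
    "\<And>i j. i \<in> {1..k} \<Longrightarrow> j \<in> {1..k} \<Longrightarrow> i \<le> j \<Longrightarrow> \<sigma> j \<le> \<sigma> i"
    and ou: "orthonormal_upto k u" and ov: "orthonormal_upto k v"
    using P by (auto simp: partial_svd_def)
  have sle: "s \<le> \<sigma> i" if "i \<in> {1..k}" for i
    using P that x y unfolding partial_svd_def s_def by blast
  have Xy: "X *v y = s *\<^sub>R x"
  proof (rule equality_in_cauchy_schwarz)
    have "\<forall>i\<in>{1..k}. (X *v y) \<bullet> u i = 0"
    proof
      fix i assume i: "i \<in> {1..k}"
      have "(X *v y) \<bullet> u i = (u i v* X) \<bullet> y"
        unfolding dot_lmul_matrix by (rule inner_commute)
      then show "(X *v y) \<bullet> u i = 0"
        using PD(1)[OF i] y(2) i by (simp add: inner_commute)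
    qed
    then show "norm (X *v y) \<le> s"
      using max y s0 by (intro norm_le_of_unit_bound[of "{1..k}" u]) (auto simp: inner_commute)
  qed (use x in \<open>auto simp: s_def inner_commute\<close>)
  have xX: "x v* X = s *\<^sub>R y"
  proof (rule equality_in_cauchy_schwarz)
    have "\<forall>i\<in>{1..k}. (x v* X) \<bullet> v i = 0"
      using PD(1) x(2) by (simp add: dot_lmul_matrix)
    then show "norm (x v* X) \<le> s"
      using max x s0 by (intro norm_le_of_unit_bound[of "{1..k}" v]) (auto simp: dot_lmul_matrix)
  qed (use y in \<open>auto simp: s_def dot_lmul_matrix\<close>)
  let ?\<sigma> = "\<sigma>(Suc k := s)" and ?u = "u(Suc k := x)" and ?v = "v(Suc k := y)"
  have split: "i \<in> {1..k} \<or> i = Suc k" if "i \<in> {1..Suc k}" for i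
    using that by auto
  have "partial_svd X (Suc k) ?\<sigma> ?u ?v"
    unfolding partial_svd_def
  proof (intro conjI)
    show "orthonormal_upto (Suc k) ?u" "orthonormal_upto (Suc k) ?v"
      using orthonormal_upto_extend[OF ou x] orthonormal_upto_extend[OF ov y] by auto
    show "\<forall>i\<in>{1..Suc k}. 0 \<le> ?\<sigma> i \<and> X *v ?v i = ?\<sigma> i *\<^sub>R ?u i \<and> ?u i v* X = ?\<sigma> i *\<^sub>R ?v i"
      using split PD(1) s0 Xy xX by auto
    show "\<forall>i\<in>{1..Suc k}. \<forall>j\<in>{1..Suc k}. i \<le> j \<longrightarrow> ?\<sigma> j \<le> ?\<sigma> i"
      using PD(2) sle by (auto simp: le_Suc_eq)
    show "\<forall>l\<in>{1..Suc k}. \<forall>x y. norm x = 1 \<and> norm y = 1 \<and>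
        (\<forall>i\<in>{1..Suc k}. x \<bullet> ?u i = 0 \<and> y \<bullet> ?v i = 0) \<longrightarrow> x \<bullet> (X *v y) \<le> ?\<sigma> l"
    proof (intro ballI allI impI, elim conjE)
      fix l a b assume l: "l \<in> {1..Suc k}" and ab: "norm a = 1" "norm b = 1"
        and o: "\<forall>i\<in>{1..Suc k}. a \<bullet> ?u i = 0 \<and> b \<bullet> ?v i = 0"
      have "a \<bullet> u i = 0 \<and> b \<bullet> v i = 0" if "i \<in> {1..k}" for i
        using bspec[OF o, of i] that by auto
      then have "a \<bullet> (X *v b) \<le> s"
        using max ab by blast
      moreover have "s \<le> ?\<sigma> l"
        using split[OF l] sle by auto
      ultimately show "a \<bullet> (X *v b) \<le> ?\<sigma> l"
        by simp
    qed
  qed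
  then show ?thesis
    by blast
qed

lemma partial_svd_exists:
  fixes X :: "real^'m^'n"
  assumes "k \<le> CARD('n)" "k \<le> CARD('m)"
  shows "\<exists>\<sigma> u v. partial_svd X k \<sigma> u v"
  using assms
proof (induction k)
  case 0
  show ?case
    by (simp add: partial_svd_def orthonormal_upto_def)
next
  case (Suc k)
  then show ?case
    using partial_svd_step[of X k] by auto
qed

text \<open>
  After n greedy steps the \<open>u i\<close> form a basis of the row index space, so \<open>X\<close> is determined by the
  products \<open>u i v* X\<close>. The assumption on the dimensions leaves room for n right singular vectors.
\<close>

theorem svd_exists:
  fixes X :: "real^'m^'n"
  assumes "CARD('n) \<le> CARD('m)"
  shows "\<exists>\<sigma> u v. is_svd X \<sigma> u v"
proof -
  let ?n = "CARD('n)"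
  obtain \<sigma> u v where P: "partial_svd X ?n \<sigma> u v"
    using partial_svd_exists[OF order_refl assms] by blast
  let ?\<sigma> = "\<lambda>i. if i \<le> ?n then \<sigma> i else 0"
  let ?S = "\<Sum>i=1..?n. ?\<sigma> i *\<^sub>R outer_prod (u i) (v i)"
  have u: "orthonormal_upto ?n u"
    and uX: "\<And>i. i \<in> {1..?n} \<Longrightarrow> u i v* X = \<sigma> i *\<^sub>R v i"
    using P by (auto simp: partial_svd_def)
  have uS: "u j v* ?S = \<sigma> j *\<^sub>R v j" if j: "j \<in> {1..?n}" for j
  proof -
    have "u j v* ?S = (\<Sum>i=1..?n. if i = j then \<sigma> j *\<^sub>R v j else 0)"
      unfolding outer_sum_vec_mult using orthonormal_uptoD[OF u j] by (intro sum.cong) auto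
    then show ?thesis
      using j by simp
  qed
  have "X = ?S"
    unfolding matrix_eq
  proof
    fix x
    show "X *v x = ?S *v x"
    proof (rule orthonormal_basis_eqI[OF u])
      fix j assume j: "j \<in> {1..?n}"
      have "(X *v x) \<bullet> u j = (u j v* X) \<bullet> x"
        unfolding dot_lmul_matrix by (rule inner_commute)
      also have "\<dots> = (u j v* ?S) \<bullet> x"
        by (simp only: uX[OF j] uS[OF j])
      also have "\<dots> = (?S *v x) \<bullet> u j"
        unfolding dot_lmul_matrix by (rule inner_commute)
      finally show "(X *v x) \<bullet> u j = (?S *v x) \<bullet> u j" .
    qed
  qed
  then have "is_svd X ?\<sigma> u v"
    using P unfolding is_svd_def partial_svd_def by auto
  then show ?thesis
    by blast
qed

section \<open>The r-norm and its dual norm\<close>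

lemma r_norm_scale:
  fixes X :: "real^'m^'n"
  assumes "CARD('n) \<le> CARD('m)" "0 \<le> c"
  shows "r_norm r (c *\<^sub>R X) = c * r_norm r X"
proof -
  obtain \<sigma> u v where X: "is_svd X \<sigma> u v"
    using svd_exists[OF assms(1)] by blast
  have "(r_norm r (c *\<^sub>R X))\<^sup>2 = (c * r_norm r X)\<^sup>2"
    unfolding power_mult_distrib r_norm_svd[OF X] r_norm_svd[OF svd_scale[OF X assms(2)]]
    by (simp add: power_mult_distrib sum_distrib_left)
  then show ?thesis
    using assms(2) r_norm_nonneg[of r X] r_norm_nonneg[of r "c *\<^sub>R X"]
    by (simp add: power2_eq_iff_nonneg)
qed

text \<open>
  The largest singular value is already counted by the r-norm, so the unit ball of the r-norm is
  bounded. This makes the supremum in the dual norm finite.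
\<close>

lemma norm_le_r_norm:
  fixes X :: "real^'m^'n"
  assumes "CARD('n) \<le> CARD('m)" "1 \<le> r"
  shows "norm X \<le> sqrt CARD('n) * r_norm r X"
proof (rule power2_le_imp_le)
  obtain \<sigma> u v where X: "is_svd X \<sigma> u v"
    using svd_exists[OF assms(1)] by blast
  note D = is_svdD[OF X]
  have "(norm X)\<^sup>2 \<le> (\<Sum>i=1..CARD('n). (\<sigma> 1)\<^sup>2)"
    unfolding svd_norm[OF X] using D(3)[of 1] D(4) by (intro sum_mono power_mono) auto
  also have "\<dots> = CARD('n) * (\<sigma> 1)\<^sup>2"
    by simp
  also have "\<dots> \<le> CARD('n) * (r_norm r X)\<^sup>2"
    unfolding r_norm_svd[OF X] using assms(2)
    by (intro mult_left_mono member_le_sum[of 1]) auto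
  finally show "(norm X)\<^sup>2 \<le> (sqrt CARD('n) * r_norm r X)\<^sup>2"
    by (simp add: power_mult_distrib)
qed (simp add: r_norm_nonneg)

lemma r_norm_zero:
  assumes "CARD('n) \<le> CARD('m)"
  shows "r_norm r (0 :: real^'m^'n) = 0"
  using r_norm_scale[OF assms, of 0 r 0] by simp

lemma r_dual_norm_upper:
  fixes M X :: "real^'m^'n"
  assumes "CARD('n) \<le> CARD('m)" "1 \<le> r" "r_norm r X \<le> 1"
  shows "M \<bullet> X \<le> r_dual_norm r M"
  unfolding r_dual_norm_def
proof (rule cSUP_upper)
  show "bdd_above ((\<bullet>) M ` {X. r_norm r X \<le> 1})"
  proof (rule bdd_aboveI2)
    fix X :: "real^'m^'n"
    assume "X \<in> {X. r_norm r X \<le> 1}"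
    then have "sqrt CARD('n) * r_norm r X \<le> sqrt CARD('n) * 1"
      by (intro mult_left_mono) auto
    then have "norm X \<le> sqrt CARD('n)"
      using norm_le_r_norm[OF assms(1,2), of X] by linarith
    then have "norm M * norm X \<le> norm M * sqrt CARD('n)"
      by (rule mult_left_mono) simp
    then show "M \<bullet> X \<le> norm M * sqrt CARD('n)"
      using norm_cauchy_schwarz[of M X] by linarith
  qed
qed (use assms(3) in simp)

lemma r_dual_norm_least:
  fixes M :: "real^'m^'n"
  assumes "CARD('n) \<le> CARD('m)" "\<And>X. r_norm r X \<le> 1 \<Longrightarrow> M \<bullet> X \<le> B"
  shows "r_dual_norm r M \<le> B"
  unfolding r_dual_norm_def
proof (rule cSUP_least)
  show "{X :: real^'m^'n. r_norm r X \<le> 1} \<noteq> {}"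
    using r_norm_zero[OF assms(1), of r] by (auto intro: exI[of _ 0])
qed (use assms(2) in simp)

lemma r_dual_norm_nonneg:
  fixes M :: "real^'m^'n"
  assumes "CARD('n) \<le> CARD('m)" "1 \<le> r"
  shows "0 \<le> r_dual_norm r M"
  using r_dual_norm_upper[OF assms, of 0 M] r_norm_zero[OF assms(1), of r] by simp

lemma inner_le_r_dual_norm:
  fixes M X :: "real^'m^'n"
  assumes "CARD('n) \<le> CARD('m)" "1 \<le> r"
  shows "M \<bullet> X \<le> r_dual_norm r M * r_norm r X"
proof (cases "r_norm r X = 0")
  case True
  then show ?thesis
    using norm_le_r_norm[OF assms, of X] by simp
next
  case False
  then have pos: "0 < r_norm r X"
    using r_norm_nonneg[of r X] by simp
  have "r_norm r (inverse (r_norm r X) *\<^sub>R X) = 1"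
    using pos by (simp add: r_norm_scale[OF assms(1)])
  then have "M \<bullet> (inverse (r_norm r X) *\<^sub>R X) \<le> r_dual_norm r M"
    by (intro r_dual_norm_upper[OF assms]) simp
  then show ?thesis
    using pos by (simp add: field_simps)
qed

lemma r_fenchel_young:
  fixes M X :: "real^'m^'n"
  assumes "CARD('n) \<le> CARD('m)" "1 \<le> r"
  shows "M \<bullet> X \<le> 1/2 * (r_dual_norm r M)\<^sup>2 + 1/2 * (r_norm r X)\<^sup>2"
  using inner_le_r_dual_norm[OF assms, of M X]
    sum_squares_bound[of "r_dual_norm r M" "r_norm r X"] by simp

text \<open>
  A supremum of linear functionals is convex, and a nonnegative convex function has a convex square.
\<close>

lemma convex_on_half_r_dual_norm_squared:
  assumes "CARD('n) \<le> CARD('m)" "1 \<le> r"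
  shows "convex_on UNIV (\<lambda>M :: real^'m^'n. 1/2 * (r_dual_norm r M)\<^sup>2)"
proof -
  have "(r_dual_norm r ((1 - t) *\<^sub>R A + t *\<^sub>R B))\<^sup>2
      \<le> (1 - t) * (r_dual_norm r A)\<^sup>2 + t * (r_dual_norm r B)\<^sup>2"
    if t: "0 < t" "t < 1" for t :: real and A B :: "real^'m^'n"
  proof -
    let ?a = "r_dual_norm r A" and ?b = "r_dual_norm r B"
    have "r_dual_norm r ((1 - t) *\<^sub>R A + t *\<^sub>R B) \<le> (1 - t) * ?a + t * ?b"
    proof (rule r_dual_norm_least[OF assms(1)])
      fix X :: "real^'m^'n"
      assume X: "r_norm r X \<le> 1"
      show "((1 - t) *\<^sub>R A + t *\<^sub>R B) \<bullet> X \<le> (1 - t) * ?a + t * ?b"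
        using t r_dual_norm_upper[OF assms X]
        by (auto simp: inner_add_left intro!: add_mono mult_left_mono)
    qed
    then have "(r_dual_norm r ((1 - t) *\<^sub>R A + t *\<^sub>R B))\<^sup>2 \<le> ((1 - t) * ?a + t * ?b)\<^sup>2"
      using r_dual_norm_nonneg[OF assms] by (intro power_mono) auto
    also have "\<dots> = (1 - t) * ?a\<^sup>2 + t * ?b\<^sup>2 - t * (1 - t) * (?a - ?b)\<^sup>2"
      by algebra
    also have "\<dots> \<le> (1 - t) * ?a\<^sup>2 + t * ?b\<^sup>2"
      using t by simp
    finally show ?thesis .
  qed
  then have "convex_on UNIV (\<lambda>M :: real^'m^'n. (r_dual_norm r M)\<^sup>2)"
    by (intro convex_onI) auto
  then show ?thesis
    by (intro convex_on_cmul) auto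
qed

section \<open>Truncated singular value decompositions\<close>

lemma svd_trunc_nonempty:
  fixes X :: "real^'m^'n"
  assumes "CARD('n) \<le> CARD('m)"
  shows "svd_trunc r X \<noteq> {}"
  using svd_exists[OF assms, of X] is_svd_sing_val[of X] by (fastforce simp: svd_trunc_def)

lemma svd_truncE:
  fixes X :: "real^'m^'n"
  assumes "P \<in> svd_trunc r X" "is_svd X \<sigma> u v"
  obtains u' v' where "is_svd X \<sigma> u' v'" "P = (\<Sum>i=1..r. \<sigma> i *\<^sub>R outer_prod (u' i) (v' i))"
proof -
  obtain u' v' where svd: "is_svd X (sing_val X) u' v'"
    and P: "P = (\<Sum>i=1..r. sing_val X i *\<^sub>R outer_prod (u' i) (v' i))"
    using assms(1) by (auto simp: svd_trunc_def)
  show thesis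
  proof (rule that)
    show "is_svd X \<sigma> u' v'"
      using svd by (rule is_svd_cong) (simp_all add: sing_val_eq[OF assms(2)])
    show "P = (\<Sum>i=1..r. \<sigma> i *\<^sub>R outer_prod (u' i) (v' i))"
      unfolding P by (rule sum.cong) (simp_all add: sing_val_eq[OF assms(2)])
  qed
qed

lemma svd_truncI:
  fixes X :: "real^'m^'n"
  assumes "is_svd X \<sigma> u v"
  shows "(\<Sum>i=1..r. \<sigma> i *\<^sub>R outer_prod (u i) (v i)) \<in> svd_trunc r X"
proof -
  have "(\<Sum>i=1..r. \<sigma> i *\<^sub>R outer_prod (u i) (v i))
      = (\<Sum>i=1..r. sing_val X i *\<^sub>R outer_prod (u i) (v i))"
    by (rule sum.cong) (simp_all add: sing_val_eq[OF assms])
  then show ?thesis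
    using is_svd_sing_val[OF assms] by (auto simp: svd_trunc_def)
qed

lemma svd_trunc_norm:
  fixes X :: "real^'m^'n"
  assumes "P \<in> svd_trunc r X" "r \<le> CARD('n)"
  shows "norm P = r_norm r X"
proof -
  obtain u v where svd: "is_svd X (sing_val X) u v"
    and P: "P = (\<Sum>i=1..r. sing_val X i *\<^sub>R outer_prod (u i) (v i))"
    using assms(1) by (auto simp: svd_trunc_def)
  have "(norm P)\<^sup>2 = (r_norm r X)\<^sup>2"
    unfolding P r_norm_svd[OF svd] using is_svdD(1,2)[OF svd] assms(2)
    by (intro norm_sum_orthonormal orthonormal_outer_prod) (auto intro: orthonormal_upto_mono)
  then show ?thesis
    using r_norm_nonneg[of r X] by (simp add: power2_eq_iff_nonneg)
qed

text \<open>
  Together with \<open>svd_trunc_norm\<close> this says that \<open>P\<close> attains the supremum of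
  \<open>P \<bullet> X - 1/2 * (norm P)\<^sup>2\<close> over matrices of rank at most r, whose value is half the squared
  r-norm of \<open>X\<close>.
\<close>

lemma svd_trunc_inner:
  fixes X :: "real^'m^'n"
  assumes "P \<in> svd_trunc r X" "r \<le> CARD('n)"
  shows "P \<bullet> X = (r_norm r X)\<^sup>2"
proof -
  obtain u v where svd: "is_svd X (sing_val X) u v"
    and P: "P = (\<Sum>i=1..r. sing_val X i *\<^sub>R outer_prod (u i) (v i))"
    using assms(1) by (auto simp: svd_trunc_def)
  have "P \<bullet> X = (\<Sum>i=1..r. sing_val X i * (u i \<bullet> (X *v v i)))"
    by (simp only: P outer_sum_inner)
  also have "\<dots> = (\<Sum>i=1..r. (sing_val X i)\<^sup>2)"
  proof (rule sum.cong)
    fix i assume "i \<in> {1..r}"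
    then have i: "i \<in> {1..CARD('n)}"
      using assms(2) by auto
    show "sing_val X i * (u i \<bullet> (X *v v i)) = (sing_val X i)\<^sup>2"
      using orthonormal_uptoD[OF is_svdD(2)[OF svd] i i]
      by (simp add: dot_lmul_matrix[symmetric] svd_left_mult_singular_vector[OF svd i]
          power2_eq_square)
  qed simp
  finally show ?thesis
    by (simp only: r_norm_svd[OF svd])
qed

lemma svd_trunc_inner_le:
  fixes X Z :: "real^'m^'n"
  assumes "P \<in> svd_trunc r X" "r \<le> CARD('n)" "CARD('n) \<le> CARD('m)"
  shows "P \<bullet> Z \<le> norm P * r_norm r Z"
proof -
  obtain u v where svd: "is_svd X (sing_val X) u v"
    and P: "P = (\<Sum>i=1..r. sing_val X i *\<^sub>R outer_prod (u i) (v i))"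
    using assms(1) by (auto simp: svd_trunc_def)
  obtain \<tau> a b where "is_svd Z \<tau> a b"
    using svd_exists[OF assms(3)] by blast
  then show ?thesis
    using is_svdD(1,2)[OF svd] assms(2) P
    by (intro inner_rank_r_le[of Z _ _ _ r u v]) (auto intro: orthonormal_upto_mono)
qed

lemma r_dual_norm_svd_trunc_le:
  fixes X :: "real^'m^'n"
  assumes "P \<in> svd_trunc r X" "r \<le> CARD('n)" "CARD('n) \<le> CARD('m)"
  shows "r_dual_norm r P \<le> r_norm r X"
proof (rule r_dual_norm_least[OF assms(3)])
  fix Z :: "real^'m^'n"
  assume "r_norm r Z \<le> 1"
  then have "norm P * r_norm r Z \<le> norm P * 1"
    by (intro mult_left_mono) auto
  then show "P \<bullet> Z \<le> r_norm r X"
    using svd_trunc_inner_le[OF assms, of Z] svd_trunc_norm[OF assms(1,2)] by linarith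
qed

lemma compact_coordinatewise:
  fixes S :: "'a::topological_space set"
  assumes "compact S"
  shows "compact {f :: 'i \<Rightarrow> 'a. \<forall>i. f i \<in> S}"
proof -
  have "{f :: 'i \<Rightarrow> 'a. \<forall>i. f i \<in> S} = PiE UNIV (\<lambda>_. S)"
    by (auto simp: PiE_def)
  moreover have "compactin (product_topology (\<lambda>_. euclidean) UNIV) (PiE (UNIV :: 'i set) (\<lambda>_. S))"
    using assms by (simp add: compactin_PiE)
  ultimately show ?thesis
    by (simp add: euclidean_product_topology)
qed

lemma continuous_on_outer_prod [continuous_intros]:
  assumes "continuous_on S f" "continuous_on S g"
  shows "continuous_on S (\<lambda>x. outer_prod (f x) (g x))"
  unfolding outer_prod_def
  by (intro continuous_on_vec_lambda continuous_on_mult continuous_on_component assms)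

lemma continuous_on_triple_coordinates:
  fixes S :: "(('i \<Rightarrow> 'a::topological_space) \<times> ('i \<Rightarrow> 'b::topological_space) \<times>
    ('i \<Rightarrow> 'c::topological_space)) set"
  shows "continuous_on S (\<lambda>p. fst p i)" "continuous_on S (\<lambda>p. fst (snd p) i)"
    "continuous_on S (\<lambda>p. snd (snd p) i)"
  by (rule continuous_on_product_then_coordinatewise, intro continuous_intros)+

text \<open>
  Decompositions with singular values at most \<open>R\<close>, as a subset of a product space. The entries at
  every index, including the irrelevant ones, are confined to fixed compact sets, so that Tychonoff's
  theorem applies. By \<open>is_svd_cong\<close> every matrix of norm at most \<open>R\<close> has all its truncations
  represented here.
\<close>

definition svd_data ::
  "real \<Rightarrow> ((nat \<Rightarrow> real) \<times> (nat \<Rightarrow> real^'n) \<times> (nat \<Rightarrow> real^'m)) set" where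
  "svd_data R =
     {f. \<forall>i. f i \<in> {0..R}} \<times> {f. \<forall>i. f i \<in> cball 0 1} \<times> {f. \<forall>i. f i \<in> cball 0 1} \<inter>
     {p. is_svd (\<Sum>i=1..CARD('n). fst p i *\<^sub>R outer_prod (fst (snd p) i) (snd (snd p) i))
           (fst p) (fst (snd p)) (snd (snd p))}"

lemma compact_svd_data:
  "compact (svd_data R :: ((nat \<Rightarrow> real) \<times> (nat \<Rightarrow> real^'n) \<times> (nat \<Rightarrow> real^'m)) set)"
  unfolding svd_data_def
proof (intro compact_Int_closed compact_Times compact_coordinatewise)
  show "closed {p :: (nat \<Rightarrow> real) \<times> (nat \<Rightarrow> real^'n) \<times> (nat \<Rightarrow> real^'m).
    is_svd (\<Sum>i=1..CARD('n). fst p i *\<^sub>R outer_prod (fst (snd p) i) (snd (snd p) i))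
           (fst p) (fst (snd p)) (snd (snd p))}"
    unfolding is_svd_def orthonormal_upto_def Ball_def
    by (intro closed_Collect_conj closed_Collect_all closed_Collect_imp open_Collect_const
        closed_Collect_eq closed_Collect_le continuous_intros continuous_on_triple_coordinates)
qed auto

text \<open>
  The matrix and its truncation are continuous functions of the decomposition, so the graph is a
  closed piece of a continuous image of \<open>svd_data R\<close>. Its compactness says that limits of truncations
  of convergent matrices are truncations of the limit, although the individual singular vectors need
  not converge.
\<close>

lemma compact_svd_trunc_graph:
  assumes "r \<le> CARD('n)"
  shows "compact {(X :: real^'m^'n, P). P \<in> svd_trunc r X \<and> norm X \<le> R}"
proof -
  let ?S = "\<lambda>k p. \<Sum>i=1..k. fst p i *\<^sub>R outer_prod (fst (snd p) i) (snd (snd p) i) :: real^'m^'n"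
  let ?D = "svd_data R :: ((nat \<Rightarrow> real) \<times> (nat \<Rightarrow> real^'n) \<times> (nat \<Rightarrow> real^'m)) set"
  let ?G = "{(X :: real^'m^'n, P). P \<in> svd_trunc r X \<and> norm X \<le> R}"
  have "continuous_on UNIV (?S k)" for k :: nat
    by (intro continuous_intros continuous_on_triple_coordinates)
  then have "continuous_on ?D (\<lambda>p. (?S CARD('n) p, ?S r p))"
    by (intro continuous_on_Pair) (auto intro: continuous_on_subset)
  then have K: "compact ((\<lambda>p. (?S CARD('n) p, ?S r p)) ` ?D)"
    using compact_svd_data by (rule compact_continuous_image)
  have G: "?G \<subseteq> (\<lambda>p. (?S CARD('n) p, ?S r p)) ` ?D"
  proof clarify
    fix X P :: "real^'m^'n"
    assume P: "P \<in> svd_trunc r X" and R: "norm X \<le> R"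
    obtain u v where svd: "is_svd X (sing_val X) u v"
      and Peq: "P = (\<Sum>i=1..r. sing_val X i *\<^sub>R outer_prod (u i) (v i))"
      using P by (auto simp: svd_trunc_def)
    note D = is_svdD[OF svd]
    define \<sigma> where "\<sigma> i = (if 1 \<le> i then sing_val X i else 0)" for i
    define u' where "u' i = (if i \<in> {1..CARD('n)} then u i else 0)" for i
    define v' where "v' i = (if i \<in> {1..CARD('n)} then v i else 0)" for i
    have svd': "is_svd X \<sigma> u' v'"
      using svd by (rule is_svd_cong) (auto simp: \<sigma>_def u'_def v'_def)
    have "(sing_val X i)\<^sup>2 \<le> (norm X)\<^sup>2" if "1 \<le> i" for i
    proof (cases "i \<le> CARD('n)")
      case True
      then show ?thesis
        unfolding svd_norm[OF svd] using that
        by (intro member_le_sum[of i _ "\<lambda>i. (sing_val X i)\<^sup>2"]) auto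
    qed (simp add: D(5))
    then have le: "sing_val X i \<le> norm X" if "1 \<le> i" for i
      using that power2_le_imp_le by (metis norm_ge_zero)
    have "\<sigma> i \<in> {0..R}" for i
      using le[of i] D(4)[of i] R norm_ge_zero[of X] order_trans[OF _ R] by (simp add: \<sigma>_def)
    moreover have "u' i \<in> cball 0 1" "v' i \<in> cball 0 1" for i
      using orthonormal_upto_norm[OF D(1)] orthonormal_upto_norm[OF D(2)]
      by (auto simp: u'_def v'_def)
    moreover have X: "X = ?S CARD('n) (\<sigma>, u', v')"
      using is_svdD(6)[OF svd'] by simp
    ultimately have "(\<sigma>, u', v') \<in> ?D"
      using svd' unfolding svd_data_def by simp
    moreover have "P = ?S r (\<sigma>, u', v')"
      unfolding Peq using assms by (auto simp: \<sigma>_def u'_def v'_def intro!: sum.cong)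
    ultimately show "(X, P) \<in> (\<lambda>p. (?S CARD('n) p, ?S r p)) ` ?D"
      using X by blast
  qed
  have "?G = (\<lambda>p. (?S CARD('n) p, ?S r p)) ` ?D \<inter> {q. norm (fst q) \<le> R}"
  proof
    show "?G \<subseteq> (\<lambda>p. (?S CARD('n) p, ?S r p)) ` ?D \<inter> {q. norm (fst q) \<le> R}"
      using G by auto
    show "(\<lambda>p. (?S CARD('n) p, ?S r p)) ` ?D \<inter> {q. norm (fst q) \<le> R} \<subseteq> ?G"
      using svd_truncI by (fastforce simp: svd_data_def)
  qed
  moreover have "closed {q :: (real^'m^'n) \<times> (real^'m^'n). norm (fst q) \<le> R}"
    by (intro closed_Collect_le continuous_intros)
  ultimately show ?thesis
    using K by (simp add: compact_Int_closed)
qed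

lemma compact_svd_trunc:
  fixes X :: "real^'m^'n"
  assumes "r \<le> CARD('n)"
  shows "compact (svd_trunc r X)"
proof -
  let ?G = "{(Y :: real^'m^'n, P). P \<in> svd_trunc r Y \<and> norm Y \<le> norm X}"
  have "compact (snd ` (?G \<inter> {X} \<times> UNIV))"
    using compact_svd_trunc_graph[OF assms, of "norm X"]
    by (intro compact_continuous_image continuous_intros compact_Int_closed closed_Times) auto
  moreover have "snd ` (?G \<inter> {X} \<times> UNIV) = svd_trunc r X"
    by force
  ultimately show ?thesis
    by simp
qed

section \<open>The subdifferential of half the squared r-norm\<close>

text \<open>
  Danskin's argument. Write f for half the squared r-norm. If \<open>M\<close> lies outside the hull, some
  hyperplane with normal \<open>Z\<close> separates the two. A truncation \<open>P k\<close> of \<open>Y - t k *\<^sub>R Z\<close> attains f there and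
  gives a lower bound for f at \<open>Y\<close>, whereas \<open>M\<close> supports f at \<open>Y\<close>. Comparing the two bounds yields
  \<open>P k \<bullet> Z \<le> M \<bullet> Z\<close>. Compactness of the graph produces as \<open>t k\<close> tends to 0 a truncation of \<open>Y\<close> itself with
  this inequality, on the wrong side of the hyperplane.
\<close>

theorem fenchel_equality_imp_svd_trunc_hull:
  fixes M Y :: "real^'m^'n"
  assumes nm: "CARD('n) \<le> CARD('m)" and r: "1 \<le> r" "r \<le> CARD('n)"
    and eq: "1/2 * (r_dual_norm r M)\<^sup>2 + 1/2 * (r_norm r Y)\<^sup>2 \<le> M \<bullet> Y"
  shows "M \<in> convex hull (svd_trunc r Y)"
proof (rule ccontr)
  assume "M \<notin> convex hull (svd_trunc r Y)"
  then obtain Z b where b: "Z \<bullet> M < b" "\<And>P. P \<in> convex hull (svd_trunc r Y) \<Longrightarrow> b < Z \<bullet> P"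
    using separating_hyperplane_closed_point[of "convex hull (svd_trunc r Y)" M]
      compact_imp_closed[OF compact_convex_hull[OF compact_svd_trunc[OF r(2)]]]
    by (metis convex_convex_hull)
  define t :: "nat \<Rightarrow> real" where "t k = inverse (real (Suc k))" for k
  define P where "P k = (SOME P. P \<in> svd_trunc r (Y - t k *\<^sub>R Z))" for k
  have t: "0 < t k" "t k \<le> 1" for k
    by (auto simp: t_def inverse_le_1_iff)
  have P: "P k \<in> svd_trunc r (Y - t k *\<^sub>R Z)" for k
    unfolding P_def using svd_trunc_nonempty[OF nm] by (metis some_in_eq)
  have le: "P k \<bullet> Z \<le> M \<bullet> Z" for k
  proof -
    let ?Y = "Y - t k *\<^sub>R Z"
    have "M \<bullet> ?Y \<le> 1/2 * (r_dual_norm r M)\<^sup>2 + 1/2 * (r_norm r ?Y)\<^sup>2"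
      by (rule r_fenchel_young[OF nm r(1)])
    moreover have "P k \<bullet> ?Y = (r_norm r ?Y)\<^sup>2" "norm (P k) = r_norm r ?Y"
      using svd_trunc_inner[OF P r(2)] svd_trunc_norm[OF P r(2)] by auto
    moreover have "P k \<bullet> Y \<le> 1/2 * (norm (P k))\<^sup>2 + 1/2 * (r_norm r Y)\<^sup>2"
      using svd_trunc_inner_le[OF P r(2) nm, of k Y] sum_squares_bound[of "norm (P k)" "r_norm r Y"]
      by simp
    ultimately have "t k * (P k \<bullet> Z) \<le> t k * (M \<bullet> Z)"
      using eq by (simp add: inner_diff_right)
    then show ?thesis
      using t by simp
  qed
  let ?G = "{(X :: real^'m^'n, P). P \<in> svd_trunc r X \<and> norm X \<le> norm Y + norm Z}"
  have "\<forall>k. (Y - t k *\<^sub>R Z, P k) \<in> ?G"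
  proof
    fix k
    have "norm (t k *\<^sub>R Z) \<le> norm Z"
      using t[of k] by (simp add: mult_left_le_one_le)
    then have "norm (Y - t k *\<^sub>R Z) \<le> norm Y + norm Z"
      using norm_triangle_ineq4[of Y "t k *\<^sub>R Z"] by linarith
    then show "(Y - t k *\<^sub>R Z, P k) \<in> ?G"
      using P by simp
  qed
  then obtain q s where q: "q \<in> ?G" and s: "strict_mono s"
    and lim: "((\<lambda>k. (Y - t k *\<^sub>R Z, P k)) \<circ> s) \<longlonglongrightarrow> q"
    by (rule seq_compactE[OF compact_imp_seq_compact[OF compact_svd_trunc_graph[OF r(2)]]])
  have "t \<longlonglongrightarrow> 0"
    unfolding t_def by (rule LIMSEQ_inverse_real_of_nat)
  then have "(\<lambda>k. Y - t k *\<^sub>R Z) \<longlonglongrightarrow> Y - 0 *\<^sub>R Z"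
    by (intro tendsto_intros)
  then have "(\<lambda>k. Y - t (s k) *\<^sub>R Z) \<longlonglongrightarrow> Y"
    using LIMSEQ_subseq_LIMSEQ[OF _ s] by (simp add: comp_def)
  moreover have "(\<lambda>k. Y - t (s k) *\<^sub>R Z) \<longlonglongrightarrow> fst q" and Plim: "(\<lambda>k. P (s k)) \<longlonglongrightarrow> snd q"
    using tendsto_fst[OF lim] tendsto_snd[OF lim] by (auto simp: comp_def)
  ultimately have "fst q = Y"
    using LIMSEQ_unique by blast
  then have "snd q \<in> svd_trunc r Y"
    using q by (cases q) auto
  then have "b < Z \<bullet> snd q"
    using b(2) hull_inc by metis
  moreover have "snd q \<bullet> Z \<le> M \<bullet> Z"
    using le by (intro LIMSEQ_le_const2[OF tendsto_inner[OF Plim tendsto_const]]) auto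
  ultimately show False
    using b(1) by (simp add: inner_commute)
qed

section \<open>Comparing two singular value decompositions of the same matrix\<close>

text \<open>
  Left singular vectors are eigenvectors of the symmetric map \<open>x \<mapsto> Y *v (x v* Y)\<close> with eigenvalue the
  squared singular value; eigenvectors for different eigenvalues are orthogonal.
\<close>

lemma singular_vectors_orthogonal:
  fixes Y :: "real^'m^'n"
  assumes svd: "is_svd Y \<sigma> u v" and svd': "is_svd Y \<sigma> u' v'"
    and ij: "i \<in> {1..CARD('n)}" "j \<in> {1..CARD('n)}" and ne: "\<sigma> i \<noteq> \<sigma> j"
  shows "u' i \<bullet> u j = 0"
proof -
  \<comment> \<open>The eigenvector equation, tested against \<open>x\<close>.\<close>
  have eig: "(x v* Y) \<bullet> (a k v* Y) = (\<sigma> k)\<^sup>2 * (x \<bullet> a k)"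
    if "is_svd Y \<sigma> a b" "k \<in> {1..CARD('n)}" for a b k and x :: "real^'n"
    using that inner_sum_orthonormal[OF is_svdD(2)[OF that(1)] that(2)]
    by (simp add: svd_left_mult_singular_vector[OF that] svd_left_mult[OF that(1), of x]
        power2_eq_square mult.assoc)
  have "(\<sigma> j)\<^sup>2 * (u' i \<bullet> u j) = (\<sigma> i)\<^sup>2 * (u' i \<bullet> u j)"
    using eig[OF svd ij(2), of "u' i"] eig[OF svd' ij(1), of "u j"]
    by (auto simp: inner_commute)
  moreover have "(\<sigma> i)\<^sup>2 \<noteq> (\<sigma> j)\<^sup>2"
    using ne is_svdD(4)[OF svd, of i] is_svdD(4)[OF svd, of j] ij
    by (simp add: power2_eq_iff_nonneg)
  ultimately show ?thesis
    by auto
qed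

text \<open>
  Every left singular vector in the truncation belongs to a singular value at least \<open>\<sigma> r\<close>, whereas
  \<open>\<sigma> j\<close> is smaller, so it is orthogonal to \<open>u j\<close>.
\<close>

lemma svd_trunc_annihilates:
  fixes Y :: "real^'m^'n"
  assumes svd: "is_svd Y \<sigma> u v" and P: "P \<in> svd_trunc r Y" and r: "r \<le> CARD('n)"
    and j: "j \<in> {1..CARD('n)}" "\<sigma> j \<noteq> \<sigma> r" "r \<le> j"
  shows "u j v* P = 0"
proof -
  obtain u' v' where svd': "is_svd Y \<sigma> u' v'"
    and Peq: "P = (\<Sum>i=1..r. \<sigma> i *\<^sub>R outer_prod (u' i) (v' i))"
    using svd_truncE[OF P svd] .
  have "\<sigma> i * (u j \<bullet> u' i) = 0" if i: "i \<in> {1..r}" for i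
  proof -
    have "\<sigma> r \<le> \<sigma> i" "\<sigma> j \<le> \<sigma> r"
      using is_svdD(3)[OF svd] i j(3) by auto
    then have "u' i \<bullet> u j = 0"
      using i j r by (intro singular_vectors_orthogonal[OF svd svd']) auto
    then show ?thesis
      by (simp add: inner_commute)
  qed
  then show ?thesis
    unfolding Peq outer_sum_vec_mult by (auto intro!: sum.neutral)
qed

lemma rank_le_of_annihilated:
  fixes M :: "real^'m^'n"
  assumes u: "orthonormal_upto CARD('n) u" and "k \<le> CARD('n)"
    and z: "\<And>j. j \<in> {k<..CARD('n)} \<Longrightarrow> u j v* M = 0"
  shows "rank M \<le> k"
proof -
  have "M *v x \<in> span (u ` {1..k})" for x
  proof -
    have "M *v x = (\<Sum>i=1..CARD('n). ((M *v x) \<bullet> u i) *\<^sub>R u i)"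
      by (simp only: orthonormal_basis_expansion[OF u])
    also have "\<dots> = (\<Sum>i\<in>{1..k}. ((M *v x) \<bullet> u i) *\<^sub>R u i)"
    proof (rule sum.mono_neutral_right)
      show "\<forall>i\<in>{1..CARD('n)} - {1..k}. ((M *v x) \<bullet> u i) *\<^sub>R u i = 0"
      proof
        fix i assume "i \<in> {1..CARD('n)} - {1..k}"
        then have "u i v* M = 0"
          by (intro z) auto
        then have "u i \<bullet> (M *v x) = 0"
          by (simp add: dot_lmul_matrix[symmetric])
        then show "((M *v x) \<bullet> u i) *\<^sub>R u i = 0"
          by (simp add: inner_commute)
      qed
    qed (use assms(2) in auto)
    finally show ?thesis
      by (metis (no_types, lifting) span_sum span_scale span_base imageI)
  qed
  then have "range ((*v) M) \<subseteq> span (u ` {1..k})"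
    by auto
  then have "rank M \<le> card (u ` {1..k})"
    unfolding rank_dim_range by (rule dim_le_card) simp
  also have "\<dots> \<le> k"
    using card_image_le[of "{1..k}" u] by simp
  finally show ?thesis .
qed

text \<open>
  The matrices annihilated from the left by \<open>u j\<close> form a subspace. For \<open>j\<close> beyond \<open>r + s\<close> it contains
  all truncations, and therefore their convex hull.
\<close>

lemma rank_svd_trunc_hull_le:
  fixes Y M :: "real^'m^'n"
  assumes svd: "is_svd Y \<sigma> u v" and M: "M \<in> convex hull (svd_trunc r Y)"
    and r: "1 \<le> r" "r + s \<le> CARD('n)"
    and gap: "r + s < CARD('n) \<Longrightarrow> \<sigma> (r + s + 1) \<noteq> \<sigma> r"
  shows "rank M \<le> r + s"
proof (rule rank_le_of_annihilated[OF is_svdD(1)[OF svd] r(2)])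
  fix j assume j: "j \<in> {r + s<..CARD('n)}"
  have "\<sigma> j \<le> \<sigma> (r + s + 1)" "\<sigma> (r + s + 1) \<le> \<sigma> r"
    using is_svdD(3)[OF svd] j r by auto
  then have "\<sigma> j \<noteq> \<sigma> r"
    using gap j by auto
  then have "svd_trunc r Y \<subseteq> {P. u j v* P = 0}"
    using j r by (auto intro: svd_trunc_annihilates[OF svd])
  moreover have "convex {P :: real^'m^'n. u j v* P = 0}"
  proof -
    have "u j v* (a *\<^sub>R A + b *\<^sub>R B) = a *\<^sub>R (u j v* A) + b *\<^sub>R (u j v* B)"
      for a b and A B :: "real^'m^'n"
      by (simp add: vec_eq_iff vector_matrix_mult_def sum.distrib sum_distrib_left algebra_simps)
    then show ?thesis
      by (simp add: convex_def)
  qed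
  ultimately have "convex hull (svd_trunc r Y) \<subseteq> {P. u j v* P = 0}"
    by (simp add: hull_minimal)
  then show "u j v* M = 0"
    using M by auto
qed

text \<open>
  With a gap after index r the two groups of left singular vectors, up to r and beyond r, of any two
  decompositions are mutually orthogonal. So every truncation has the same action on the basis \<open>u\<close>:
  it agrees with \<open>Y\<close> on the first group and vanishes on the second. If \<open>\<sigma> r\<close> is 0, nothing is truncated
  and the matrix is \<open>Y\<close> itself.
\<close>

lemma svd_trunc_unique:
  fixes Y :: "real^'m^'n"
  assumes svd: "is_svd Y \<sigma> u v" and r: "1 \<le> r" "r \<le> CARD('n)"
    and gap: "\<sigma> r \<noteq> \<sigma> (r + 1) \<or> \<sigma> r = 0"
  shows "svd_trunc r Y = {\<Sum>i=1..r. \<sigma> i *\<^sub>R outer_prod (u i) (v i)}"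
proof -
  let ?n = "CARD('n)"
  let ?T = "\<lambda>k u' v'. \<Sum>i=1..k. \<sigma> i *\<^sub>R outer_prod (u' i) (v' i) :: real^'m^'n"
  have "P = ?T r u v" if PY: "P \<in> svd_trunc r Y" for P
  proof -
    obtain u' v' where svd': "is_svd Y \<sigma> u' v'" and P: "P = ?T r u' v'"
      using svd_truncE[OF PY svd] .
    have zero: "?T r a b = Y" if "is_svd Y \<sigma> a b" "\<sigma> r = 0" for a b
    proof -
      have "\<sigma> i = 0" if "r \<le> i" for i
        using is_svdD(3)[OF svd r(1) that] is_svdD(4)[OF svd, of i] \<open>\<sigma> r = 0\<close> r(1) that by simp
      then have "?T ?n a b = ?T r a b"
        using r by (intro sum.mono_neutral_right) auto
      then show ?thesis
        using is_svdD(6)[OF that(1)] by simp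
    qed
    show ?thesis
    proof (cases "\<sigma> r = 0")
      case True
      then show ?thesis
        using zero[OF svd] zero[OF svd'] P by simp
    next
      case False
      then have gap: "\<sigma> (r + 1) < \<sigma> r"
        using gap is_svdD(3)[OF svd r(1), of "r + 1"] by simp
      have T: "u j v* ?T r a b = (if j \<le> r then u j v* Y else 0)"
        if ab: "is_svd Y \<sigma> a b" and j: "j \<in> {1..?n}" for a b j
      proof -
        have orth: "u j \<bullet> a i = 0" if "i \<in> {1..?n}" "i \<le> r \<and> r < j \<or> j \<le> r \<and> r < i" for i
        proof -
          have "\<sigma> i \<noteq> \<sigma> j"
            using gap that is_svdD(3)[OF svd, of i r] is_svdD(3)[OF svd, of j r]
              is_svdD(3)[OF svd, of "r + 1" i] is_svdD(3)[OF svd, of "r + 1" j] j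
            by auto
          then show ?thesis
            using singular_vectors_orthogonal[OF svd ab that(1) j] by (simp add: inner_commute)
        qed
        show ?thesis
        proof (cases "j \<le> r")
          case True
          have "u j v* Y = u j v* ?T ?n a b"
            using is_svdD(6)[OF ab] by simp
          also have "\<dots> = u j v* ?T r a b"
            unfolding outer_sum_vec_mult using r True orth
            by (intro sum.mono_neutral_right) auto
          finally show ?thesis
            using True by simp
        next
          case False
          then show ?thesis
            unfolding outer_sum_vec_mult using r orth by (auto intro!: sum.neutral)
        qed
      qed
      show ?thesis
        unfolding matrix_eq
      proof
        fix x
        show "P *v x = ?T r u v *v x"
        proof (rule orthonormal_basis_eqI[OF is_svdD(1)[OF svd]])
          fix j assume j: "j \<in> {1..?n}"
          have "u j \<bullet> (P *v x) = u j \<bullet> (?T r u v *v x)"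
            unfolding P dot_lmul_matrix[symmetric] by (simp only: T[OF svd j] T[OF svd' j])
          then show "(P *v x) \<bullet> u j = (?T r u v *v x) \<bullet> u j"
            by (simp only: inner_commute[of _ "u j"])
        qed
      qed
    qed
  qed
  then show ?thesis
    using svd_truncI[OF svd, of r] by blast
qed

section \<open>Fenchel duality\<close>

text \<open>
  The epigraph of \<open>g\<close> and the strict hypograph of the concave function \<open>h x0 + c - h\<close> are disjoint
  convex sets, which touch at \<open>(x0, c)\<close> because \<open>x0\<close> minimises the sum. A separating hyperplane is the graph of
  an affine function with slope \<open>- d\<close> lying between the two functions; it is not vertical because \<open>h\<close> is
  finite everywhere.
\<close>

lemma separating_subgradient:
  fixes h :: "'a::euclidean_space \<Rightarrow> real" and g :: "'a \<Rightarrow> ereal"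
  assumes h: "convex_on UNIV h" and g: "convex (ereal_epigraph g)"
    and c: "g x0 = ereal c" and min: "\<And>x. ereal (h x0) + g x0 \<le> ereal (h x) + g x"
  shows "\<exists>d. (\<forall>x. h x0 + d \<bullet> (x - x0) \<le> h x) \<and> (\<forall>x. ereal (c - d \<bullet> (x - x0)) \<le> g x)"
proof -
  let ?T = "{(x, t). t < h x0 + c - h x}"
  have "convex ?T"
    unfolding convex_alt
  proof clarsimp
    fix x y and s t \<tau> :: real
    assume s: "s < h x0 + c - h x" and t: "t < h x0 + c - h y" and \<tau>: "0 \<le> \<tau>" "\<tau> \<le> 1"
    have "(1 - \<tau>) * s + \<tau> * t < (1 - \<tau>) * (h x0 + c - h x) + \<tau> * (h x0 + c - h y)"
    proof (cases "\<tau> = 0")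
      case False
      then show ?thesis
        using s t \<tau> by (intro add_le_less_mono mult_left_mono mult_strict_left_mono) auto
    qed (use s in simp)
    also have "\<dots> = h x0 + c - ((1 - \<tau>) * h x + \<tau> * h y)"
      by algebra
    also have "\<dots> \<le> h x0 + c - h ((1 - \<tau>) *\<^sub>R x + \<tau> *\<^sub>R y)"
      using convex_onD[OF h \<tau>, of x y] by simp
    finally show "(1 - \<tau>) * s + \<tau> * t < h x0 + c - h ((1 - \<tau>) *\<^sub>R x + \<tau> *\<^sub>R y)" .
  qed
  moreover have "(x0, c) \<in> ereal_epigraph g" "(x0, c - 1) \<in> ?T"
    using c by (auto simp: ereal_epigraph_def)
  then have "ereal_epigraph g \<noteq> {}" "?T \<noteq> {}"
    by blast+
  moreover have "ereal_epigraph g \<inter> ?T = {}"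
  proof -
    have False if "g x \<le> ereal t" "t < h x0 + c - h x" for x t
    proof -
      have "ereal (h x0 + c) \<le> ereal (h x) + ereal t"
        using min[of x] that(1) c by (metis add_left_mono order_trans plus_ereal.simps(1))
      then show False
        using that(2) by simp
    qed
    then show ?thesis
      by (auto simp: ereal_epigraph_def)
  qed
  ultimately obtain a b where "a \<noteq> 0"
    and S: "\<And>z. z \<in> ereal_epigraph g \<Longrightarrow> a \<bullet> z \<le> b" and T: "\<And>z. z \<in> ?T \<Longrightarrow> b \<le> a \<bullet> z"
    using separating_hyperplane_sets[OF g, of ?T] by metis
  obtain p q where a: "a = (p, q)"
    by (cases a)
  have S': "p \<bullet> x + q * t \<le> b" if "g x \<le> ereal t" for x t
    using S[of "(x, t)"] that by (simp add: a ereal_epigraph_def)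
  have T': "b \<le> p \<bullet> x + q * t" if "t < h x0 + c - h x" for x t
    using T[of "(x, t)"] that by (simp add: a)
  have b1: "p \<bullet> x0 + q * c \<le> b"
    using S'[of x0 c] c by simp
  have "q < 0"
  proof -
    have "b \<le> p \<bullet> x0 + q * (c - 1)"
      by (rule T') simp
    then have "q \<le> 0"
      using b1 by (simp add: right_diff_distrib)
    moreover have "q \<noteq> 0"
    proof
      assume q: "q = 0"
      \<comment> \<open>A vertical hyperplane would bound \<open>p \<bullet> x\<close> from below for all \<open>x\<close>; the point \<open>x0 - p\<close> violates this.\<close>
      have "b \<le> p \<bullet> (x0 - p)"
        using T'[of "h x0 + c - h (x0 - p) - 1" "x0 - p"] q by simp
      then have "p \<bullet> p \<le> 0"
        using b1 q by (simp add: inner_diff_right)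
      then show False
        using \<open>a \<noteq> 0\<close> q a by (metis inner_gt_zero_iff not_less zero_prod_def)
    qed
    ultimately show ?thesis
      by simp
  qed
  \<comment> \<open>The hypograph is strict; its boundary is reached in the limit.\<close>
  have T'': "b \<le> p \<bullet> x + q * (h x0 + c - h x)" for x
  proof (rule field_le_epsilon)
    fix e :: real assume "0 < e"
    then have "b \<le> p \<bullet> x + q * (h x0 + c - h x - e / - q)"
      using \<open>q < 0\<close> \<open>0 < e\<close> by (intro T') (simp add: divide_pos_neg)
    also have "q * (h x0 + c - h x - e / - q) = q * (h x0 + c - h x) + e"
      using \<open>q < 0\<close> by (simp add: field_simps)
    finally show "b \<le> p \<bullet> x + q * (h x0 + c - h x) + e"
      by simp
  qed
  have div: "z \<le> (p /\<^sub>R q) \<bullet> y \<longleftrightarrow> p \<bullet> y \<le> q * z" "(p /\<^sub>R q) \<bullet> y \<le> z \<longleftrightarrow> q * z \<le> p \<bullet> y" for y z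
    using \<open>q < 0\<close> by (auto simp: field_simps)
  show ?thesis
  proof (intro exI[of _ "p /\<^sub>R q"] conjI allI)
    show "h x0 + (p /\<^sub>R q) \<bullet> (x - x0) \<le> h x" for x
    proof -
      have "(p /\<^sub>R q) \<bullet> (x - x0) \<le> h x - h x0"
        unfolding div using T''[of x] b1 by (simp add: algebra_simps)
      then show ?thesis
        by simp
    qed
    show "ereal (c - (p /\<^sub>R q) \<bullet> (x - x0)) \<le> g x" for x
    proof (rule ereal_le_real)
      fix t assume "g x \<le> ereal t"
      then have "p \<bullet> x + q * t \<le> b" 
        by (rule S')
      then have "c - t \<le> (p /\<^sub>R q) \<bullet> (x - x0)"
        unfolding div using T''[of x0] by (simp add: algebra_simps)
      then show "ereal (c - (p /\<^sub>R q) \<bullet> (x - x0)) \<le> ereal t"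
        by simp
    qed
  qed
qed

text \<open>
  Optimality of \<open>Mstar\<close> yields a dual point \<open>D\<close> such that \<open>N + D\<close> is a subgradient of half the squared
  dual norm and \<open>- D\<close> one of \<open>g\<close> at \<open>Mstar\<close>. The dual objective at \<open>D\<close> is therefore minus the primal
  optimum. As \<open>Dstar\<close> does at least as well, and \<open>g\<close> and its conjugate satisfy the Fenchel-Young
  inequality, the remaining Fenchel-Young inequality at \<open>(Mstar, N + Dstar)\<close> must be tight.
\<close>

lemma optimal_pair_fenchel_equality:
  fixes N Dstar Mstar :: "real^'m^'n" and g :: "real^'m^'n \<Rightarrow> ereal"
  assumes nm: "CARD('n) \<le> CARD('m)" and r: "1 \<le> r" "r \<le> CARD('n)"
    and proper: "\<And>M. g M \<noteq> -\<infinity>" "g M' < \<infinity>" and g: "convex (ereal_epigraph g)"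
    and dual: "\<And>D. fenchel_conjugate g (- Dstar)
                  + ereal (1/2 * (r_norm r (N + Dstar))\<^sup>2 - 1/2 * (norm N)\<^sup>2)
                \<le> fenchel_conjugate g (- D)
                  + ereal (1/2 * (r_norm r (N + D))\<^sup>2 - 1/2 * (norm N)\<^sup>2)"
    and primal: "\<And>M. ereal (1/2 * (r_dual_norm r Mstar)\<^sup>2 - N \<bullet> Mstar + 1/2 * (norm N)\<^sup>2) + g Mstar
                \<le> ereal (1/2 * (r_dual_norm r M)\<^sup>2 - N \<bullet> M + 1/2 * (norm N)\<^sup>2) + g M"
  shows "1/2 * (r_dual_norm r Mstar)\<^sup>2 + 1/2 * (r_norm r (N + Dstar))\<^sup>2 \<le> Mstar \<bullet> (N + Dstar)"
proof -
  let ?h = "\<lambda>M. 1/2 * (r_dual_norm r M)\<^sup>2 - N \<bullet> M + 1/2 * (norm N)\<^sup>2"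
  have "g Mstar \<noteq> \<infinity>"
    using primal[of M'] proper(2) by (cases "g M'") auto
  then obtain c where c: "g Mstar = ereal c"
    using proper(1)[of Mstar] by (cases "g Mstar") auto
  have "convex_on UNIV ?h"
  proof -
    have "convex_on UNIV (\<lambda>M. - N \<bullet> M + k)" for k :: real
      by (intro convex_onI) (auto simp: algebra_simps inner_add_right)
    from convex_on_add[OF convex_on_half_r_dual_norm_squared[OF nm r(1)] this]
    show ?thesis
      by (simp add: algebra_simps)
  qed
  then obtain D where h: "\<And>M. ?h Mstar + D \<bullet> (M - Mstar) \<le> ?h M"
    and gD: "\<And>M. ereal (c - D \<bullet> (M - Mstar)) \<le> g M"
    using separating_subgradient[OF _ g c primal] by blast
  have conj_D: "fenchel_conjugate g (- D) \<le> ereal (- (D \<bullet> Mstar) - c)"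
    unfolding fenchel_conjugate_def
  proof (rule SUP_least)
    fix M
    have "ereal (- D \<bullet> M) - g M \<le> ereal (- D \<bullet> M) - ereal (c - D \<bullet> (M - Mstar))"
      by (rule ereal_minus_mono[OF order_refl gD])
    also have "\<dots> = ereal (- (D \<bullet> Mstar) - c)"
      by (simp add: inner_diff_right)
    finally show "ereal (- D \<bullet> M) - g M \<le> ereal (- (D \<bullet> Mstar) - c)" .
  qed
  have conj_Dstar: "ereal (- (Dstar \<bullet> Mstar) - c) \<le> fenchel_conjugate g (- Dstar)"
    unfolding fenchel_conjugate_def
    by (rule SUP_upper2[of Mstar]) (simp_all add: c)
  \<comment> \<open>The conjugate of half the squared dual norm dominates half the squared r-norm: test the
    subgradient inequality at a truncation, whose dual norm is at most the r-norm of \<open>N + D\<close>.\<close>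
  have bound: "1/2 * (r_norm r (N + D))\<^sup>2 \<le> Mstar \<bullet> (N + D) - 1/2 * (r_dual_norm r Mstar)\<^sup>2"
  proof -
    obtain P where P: "P \<in> svd_trunc r (N + D)"
      using svd_trunc_nonempty[OF nm] by blast
    have "1/2 * (r_dual_norm r P)\<^sup>2 \<le> 1/2 * (r_norm r (N + D))\<^sup>2"
      using r_dual_norm_svd_trunc_le[OF P r(2) nm] r_dual_norm_nonneg[OF nm r(1)]
      by (simp add: power_mono)
    moreover have "P \<bullet> (N + D) = (r_norm r (N + D))\<^sup>2"
      by (rule svd_trunc_inner[OF P r(2)])
    ultimately show ?thesis
      using h[of P] by (simp add: inner_diff_right inner_add_right inner_commute)
  qed
  have "ereal (- (Dstar \<bullet> Mstar) - c) + ereal (1/2 * (r_norm r (N + Dstar))\<^sup>2 - 1/2 * (norm N)\<^sup>2)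
      \<le> fenchel_conjugate g (- Dstar) + ereal (1/2 * (r_norm r (N + Dstar))\<^sup>2 - 1/2 * (norm N)\<^sup>2)"
    by (rule add_right_mono[OF conj_Dstar])
  also have "\<dots> \<le> fenchel_conjugate g (- D) + ereal (1/2 * (r_norm r (N + D))\<^sup>2 - 1/2 * (norm N)\<^sup>2)"
    by (rule dual)
  also have "\<dots> \<le> ereal (- (D \<bullet> Mstar) - c) + ereal (1/2 * (r_norm r (N + D))\<^sup>2 - 1/2 * (norm N)\<^sup>2)"
    by (rule add_right_mono[OF conj_D])
  finally have "- (Dstar \<bullet> Mstar) + 1/2 * (r_norm r (N + Dstar))\<^sup>2
      \<le> - (D \<bullet> Mstar) + 1/2 * (r_norm r (N + D))\<^sup>2"
    by simp
  then show ?thesis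
    using bound by (simp add: inner_add_right inner_commute)
qed

lemma is_arg_min_UNIV_le:
  fixes f :: "'a \<Rightarrow> 'b::linorder"
  assumes "is_arg_min f (\<lambda>_. True) x"
  shows "f x \<le> f y"
  using assms by (simp add: is_arg_min_linorder)

theorem theorem2:
  fixes N Dstar Mstar :: "real^'m^'n"
    and g :: "real^'m^'n \<Rightarrow> ereal"
    and r s :: nat
    and \<sigma> :: "nat \<Rightarrow> real"
    and u :: "nat \<Rightarrow> real^'n"
    and v :: "nat \<Rightarrow> real^'m"
  assumes "CARD('n) \<le> CARD('m)"
    and "1 \<le> r" and "r \<le> CARD('n)"
    and "\<And>M. g M \<noteq> -\<infinity>"
    and "closed_proper_convex g"
    and "\<exists>M. rank M \<le> r \<and> g M < \<infinity>"
    and "is_arg_min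
           (\<lambda>D. fenchel_conjugate g (- D)
                 + ereal (1/2 * (r_norm r (N + D))\<^sup>2 - 1/2 * (norm N)\<^sup>2))
           (\<lambda>_. True) Dstar"
    and "is_arg_min
           (\<lambda>M. ereal (1/2 * (r_dual_norm r M)\<^sup>2 - N \<bullet> M + 1/2 * (norm N)\<^sup>2) + g M)
           (\<lambda>_. True) Mstar"
    and "is_svd (N + Dstar) \<sigma> u v"
    and "r + s \<le> CARD('n)"
    and "\<forall>i\<in>{r..r+s}. \<sigma> i = \<sigma> r"
    and "if \<sigma> CARD('n) = \<sigma> r then s = CARD('n) - r else \<sigma> (r + s + 1) \<noteq> \<sigma> (r + s)"
  shows "Mstar \<in> convex hull (svd_trunc r (N + Dstar)) \<and>
         rank Mstar \<le> r + s \<and>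
         (\<sigma> r \<noteq> \<sigma> (r + 1) \<or> \<sigma> r = 0 \<longrightarrow> svd_trunc r (N + Dstar) = {Mstar})"
proof -
  obtain M' where M': "g M' < \<infinity>"
    using assms(6) by blast
  have convex: "convex (ereal_epigraph g)"
    using assms(5) by (simp add: closed_proper_convex_def)
  have "1/2 * (r_dual_norm r Mstar)\<^sup>2 + 1/2 * (r_norm r (N + Dstar))\<^sup>2 \<le> Mstar \<bullet> (N + Dstar)"
    by (rule optimal_pair_fenchel_equality[where g = g, OF assms(1-4) M' convex
          is_arg_min_UNIV_le[OF assms(7)] is_arg_min_UNIV_le[OF assms(8)]])
  then have hull: "Mstar \<in> convex hull (svd_trunc r (N + Dstar))"
    by (rule fenchel_equality_imp_svd_trunc_hull[OF assms(1-3)])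
  moreover have "rank Mstar \<le> r + s"
  proof (rule rank_svd_trunc_hull_le[OF assms(9) hull assms(2,10)])
    assume "r + s < CARD('n)"
    moreover have "\<sigma> (r + s) = \<sigma> r"
      by (rule bspec[OF assms(11)]) simp
    ultimately show "\<sigma> (r + s + 1) \<noteq> \<sigma> r"
      using assms(3,12) by (auto split: if_splits)
  qed
  moreover have "svd_trunc r (N + Dstar) = {Mstar}" if "\<sigma> r \<noteq> \<sigma> (r + 1) \<or> \<sigma> r = 0"
    using hull svd_trunc_unique[OF assms(9,2,3) that] by simp
  ultimately show ?thesis
    by blast
qed

end
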